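(* Let $\Omega_h=\{(x,y)\in\mathbb{R}^2: x^2+y^2<1,\ y>0\}$ and let $\gamma\in L^2(\Omega_h)$ be real-valued. Put $f_n(\phi)=g_n(\phi)=\sin(n\phi)$, $\phi\in[0,\pi]$, $n\ge1$. Then $\gamma$ is recovered from the linearized incomplete Dirichlet-to-Neumann map ${\Lambda^{inc}_{1,\gamma}}'$ (see context) by the formula in polar coordinates (convergence in $L^2(\Omega_h)$) $$\gamma(r,\phi)=\frac12\sum_{n=0}^\infty L_n^0(r)\,p_{n,0}+\sum_{k=1}^\infty\sum_{n=0}^\infty L_n^k(r)\cos(k\phi)\,p_{n,k},\qquad \phi\in[0,\pi],$$ with $$p_{n,k}=\sum_{l=0}^n 2(-1)^{n-l}(2n+k+1)\frac{\prod_{j=0}^{n-1}(1+k+l+j)}{l!\,(n-l)!}\cdot\frac{2\langle{\Lambda^{inc}_{1,\gamma}}'f_{l+1},g_{l+k+1}\rangle}{(l+1)(l+1+k)\pi}.$$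
   Context: Let $\Gamma=\partial\Omega_h\cap\{y>0\}$ (parametrized by the polar angle $\phi$) and $\Gamma_0=\partial\Omega_h\cap\{y=0\}$. For $f$ on $\Gamma$, $u_{f,1}$ is the solution of $\Delta u_{f,1}=0$ in $\Omega_h$, $u_{f,1}=f$ on $\Gamma$, $u_{f,1}=0$ on $\Gamma_0$; for $f=\sin(n\phi)$ it is $u_{f,1}=r^n\sin(n\phi)$. The linearized incomplete Dirichlet-to-Neumann map is $\langle{\Lambda^{inc}_{1,\gamma}}'f,g\rangle=\int_{\Omega_h}\gamma\,\nabla u_{f,1}\cdot\nabla u_{g,1}\,dx$. For integers $k\ge0$, $n\ge0$: $L_n^k(x):=\sum_{l=0}^n c^k_{l,n}x^{2l+k}$ with $c^k_{l,n}:=\dfrac{\prod_{j=0}^{n-1}(l+j+k+1)}{\prod_{j=0,\,j\ne l}^{n}(l-j)}$. Empty products equal $1$. *)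

theory Defs
  imports "HOL-Analysis.Analysis"
begin

definition half_disk :: "(real \<times> real) set" where
  "half_disk = {(x, y). x\<^sup>2 + y\<^sup>2 < 1 \<and> y > 0}"

definition Gamma_arc :: "(real \<times> real) set" where
  "Gamma_arc = {p \<in> frontier half_disk. snd p > 0}"

definition Gamma_0 :: "(real \<times> real) set" where
  "Gamma_0 = {p \<in> frontier half_disk. snd p = 0}"

text \<open>The polar radius is the norm of \<open>real \<times> real\<close>, which is Euclidean. On the closed upper half
  plane without the origin, \<open>Arg\<close> takes its values in \<open>{0..pi}\<close>.\<close>

definition polar_angle :: "real \<times> real \<Rightarrow> real" where
  "polar_angle p = Arg (Complex (fst p) (snd p))"


definition grad :: "('a::euclidean_space \<Rightarrow> real) \<Rightarrow> 'a \<Rightarrow> 'a" where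
  "grad u x = (THE D. GDERIV u x :> D)"

definition hessian :: "('a::euclidean_space \<Rightarrow> real) \<Rightarrow> 'a \<Rightarrow> 'a \<Rightarrow> 'a" where
  "hessian u x = frechet_derivative (grad u) (at x)"

definition laplacian :: "('a::euclidean_space \<Rightarrow> real) \<Rightarrow> 'a \<Rightarrow> real" where
  "laplacian u x = (\<Sum>b\<in>Basis. hessian u x b \<bullet> b)"

definition C2_on :: "'a::euclidean_space set \<Rightarrow> ('a \<Rightarrow> real) \<Rightarrow> bool" where
  "C2_on S u \<longleftrightarrow>
     (\<forall>x\<in>S. u differentiable (at x) \<and> grad u differentiable (at x)) \<and>
     (\<forall>b\<in>Basis. continuous_on S (\<lambda>x. hessian u x b))"

definition harmonic_on :: "'a::euclidean_space set \<Rightarrow> ('a \<Rightarrow> real) \<Rightarrow> bool" where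
  "harmonic_on S u \<longleftrightarrow> C2_on S u \<and> (\<forall>x\<in>S. laplacian u x = 0)"

text \<open>Classical solutions, continuous up to the boundary; they exist for continuous \<open>f\<close> on
  \<open>{0..pi}\<close> with \<open>f 0 = f pi = 0\<close> and are unique on the closed half disk, so the choice in
  \<open>dirichlet_sol\<close> only affects values outside of it.\<close>

definition solves_dirichlet :: "(real \<Rightarrow> real) \<Rightarrow> (real \<times> real \<Rightarrow> real) \<Rightarrow> bool" where
  "solves_dirichlet f u \<longleftrightarrow>
     continuous_on (closure half_disk) u \<and>
     harmonic_on half_disk u \<and>
     (\<forall>p\<in>Gamma_arc. u p = f (polar_angle p)) \<and>
     (\<forall>p\<in>Gamma_0. u p = 0)"

definition dirichlet_sol :: "(real \<Rightarrow> real) \<Rightarrow> real \<times> real \<Rightarrow> real" where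
  "dirichlet_sol f = (SOME u. solves_dirichlet f u)"

definition lin_DN_inc :: "(real \<times> real \<Rightarrow> real) \<Rightarrow> (real \<Rightarrow> real) \<Rightarrow> (real \<Rightarrow> real) \<Rightarrow> real" where
  "lin_DN_inc \<gamma> f g =
     (\<integral>x. \<gamma> x * (grad (dirichlet_sol f) x \<bullet> grad (dirichlet_sol g) x) \<partial>lebesgue_on half_disk)"


text \<open>Elements of \<open>L\<^sup>2(A)\<close> are represented by functions; in particular \<open>L2_converges\<close> and
  \<open>L2_sums\<close> determine the limit only up to null sets. Square integrability is part of
  \<open>L2_converges\<close>, which keeps the Bochner integral in \<open>L2_dist\<close> meaningful.\<close>

definition L2_on :: "'a::euclidean_space set \<Rightarrow> ('a \<Rightarrow> real) \<Rightarrow> bool" where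
  "L2_on A f \<longleftrightarrow>
     f \<in> borel_measurable (lebesgue_on A) \<and> integrable (lebesgue_on A) (\<lambda>x. (f x)\<^sup>2)"

definition L2_dist :: "'a::euclidean_space set \<Rightarrow> ('a \<Rightarrow> real) \<Rightarrow> ('a \<Rightarrow> real) \<Rightarrow> real" where
  "L2_dist A f g = sqrt (\<integral>x. (f x - g x)\<^sup>2 \<partial>lebesgue_on A)"

definition L2_converges ::
  "'a::euclidean_space set \<Rightarrow> (nat \<Rightarrow> 'a \<Rightarrow> real) \<Rightarrow> ('a \<Rightarrow> real) \<Rightarrow> bool" where
  "L2_converges A F f \<longleftrightarrow>
     (\<forall>N. L2_on A (F N)) \<and> L2_on A f \<and> (\<lambda>N. L2_dist A (F N) f) \<longlonglongrightarrow> 0"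

definition L2_sums ::
  "'a::euclidean_space set \<Rightarrow> (nat \<Rightarrow> 'a \<Rightarrow> real) \<Rightarrow> ('a \<Rightarrow> real) \<Rightarrow> bool" where
  "L2_sums A F s \<longleftrightarrow> L2_converges A (\<lambda>N x. \<Sum>n<N. F n x) s"


definition L_coeff :: "nat \<Rightarrow> nat \<Rightarrow> nat \<Rightarrow> real" where
  "L_coeff k l n =
     (\<Prod>j<n. real (l + j + k + 1)) / (\<Prod>j\<in>{0..n} - {l}. real l - real j)"

definition L_poly :: "nat \<Rightarrow> nat \<Rightarrow> real \<Rightarrow> real" where
  "L_poly k n x = (\<Sum>l=0..n. L_coeff k l n * x ^ (2 * l + k))"

definition sin_data :: "nat \<Rightarrow> real \<Rightarrow> real" where
  "sin_data n \<phi> = sin (real n * \<phi>)"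

definition p_coeff :: "(real \<times> real \<Rightarrow> real) \<Rightarrow> nat \<Rightarrow> nat \<Rightarrow> real" where
  "p_coeff \<gamma> n k =
     (\<Sum>l=0..n. 2 * (- 1) ^ (n - l) * real (2 * n + k + 1)
        * ((\<Prod>j<n. real (1 + k + l + j)) / (fact l * fact (n - l)))
        * (2 * lin_DN_inc \<gamma> (sin_data (l + 1)) (sin_data (l + k + 1))
           / (real (l + 1) * real (l + 1 + k) * pi)))"

end

(* For w = cpx p, Im (w ^ n) solves the Dirichlet problem with data sin (n phi), so
   Re ((w ^ a)' * cnj ((w ^ b)')) identifies the data of the linearized map with the moments of gamma
   against r ^ (2 l + k) cos (k phi).  The functions L_n^k(r) cos (k phi) are obtained from these by
   Gram-Schmidt for fixed k; their orthogonality and norms drop out of Lagrange interpolation of the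
   numerator of the coefficients c^k_{l,n} at the nodes 0..n, evaluated at a negative integer.  Hence
   the p_{n,k} are Fourier coefficients.  Completeness: on the upper half plane Re w and |w|^2
   separate points, so the span of the monomials, an algebra by the product formula for cosines, is
   uniformly dense by Stone-Weierstrass. *)

theory Submission
  imports Defs
begin

section \<open>Orthogonal series of square-integrable functions\<close>

text \<open>Three obstacles shape the proof. The sum in the theorem is iterated: each fixed k must
  have its own L^2 limit before the sum over k starts, whereas orthogonality controls finite
  rectangles of indices. The limits for fixed k come from completeness of L^2, and rectangles can be
  widened to full rows because the best-approximation bound does not depend on the width. Next,
  \<open>dirichlet_sol\<close> is a choice among solutions, so its gradient is known only after a
  maximum principle has given uniqueness. Finally, the moments are found without integrating in
  polar coordinates: rotation invariance kills the mixed ones, areas of disks give the radial ones,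
  and the reflection in the x-axis passes from the disk to its upper half.

  \<open>L_poly k n\<close> is the radial Zernike polynomial of degree 2n+k and azimuthal order k.
  Times cos (k phi), its squared norm on the half disk is pi / (4 (2n+k+1)) for k >= 1 and twice
  that for k = 0, since the mean square of cos (k phi) is 1/2 for k >= 1 and 1 for k = 0. This is
  where the factor 1/2 in front of the first series comes from.\<close>

definition sq_integrable :: "'a measure \<Rightarrow> ('a \<Rightarrow> real) \<Rightarrow> bool" where
  "sq_integrable M f \<longleftrightarrow> f \<in> borel_measurable M \<and> integrable M (\<lambda>x. (f x)\<^sup>2)"

lemma sq_integrable_measurable [measurable_dest]: "sq_integrable M f \<Longrightarrow> f \<in> borel_measurable M"
  by (simp add: sq_integrable_def)

lemma sq_integrable_square: "sq_integrable M f \<Longrightarrow> integrable M (\<lambda>x. (f x)\<^sup>2)"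
  by (simp add: sq_integrable_def)

lemma sq_integrable_times:
  assumes "sq_integrable M f" "sq_integrable M g"
  shows "integrable M (\<lambda>x. f x * g x)"
proof (rule Bochner_Integration.integrable_bound)
  show "integrable M (\<lambda>x. (f x)\<^sup>2 + (g x)\<^sup>2)"
    using assms by (simp add: sq_integrable_def)
  show "(\<lambda>x. f x * g x) \<in> borel_measurable M"
    using assms by (auto simp: sq_integrable_def)
  have "norm (u * v) \<le> norm (u\<^sup>2 + v\<^sup>2)" for u v :: real
  proof -
    have "2 * \<bar>u * v\<bar> \<le> u\<^sup>2 + v\<^sup>2"
      using sum_squares_bound[of "\<bar>u\<bar>" "\<bar>v\<bar>"] by (simp add: abs_mult)
    moreover have "0 \<le> \<bar>u * v\<bar>" by simp
    ultimately have "\<bar>u * v\<bar> \<le> u\<^sup>2 + v\<^sup>2" by linarith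
    then show ?thesis by simp
  qed
  then show "AE x in M. norm (f x * g x) \<le> norm ((f x)\<^sup>2 + (g x)\<^sup>2)" by simp
qed

lemma sq_integrable_add:
  assumes "sq_integrable M f" "sq_integrable M g"
  shows "sq_integrable M (\<lambda>x. f x + g x)"
  using assms sq_integrable_times[OF assms]
  by (auto simp: sq_integrable_def power2_sum mult.assoc)

lemma sq_integrable_cmult:
  assumes "sq_integrable M f"
  shows "sq_integrable M (\<lambda>x. c * f x)"
  using assms by (auto simp: sq_integrable_def power_mult_distrib)

lemma sq_integrable_diff:
  assumes "sq_integrable M f" "sq_integrable M g"
  shows "sq_integrable M (\<lambda>x. f x - g x)"
  using sq_integrable_add[OF assms(1) sq_integrable_cmult[OF assms(2), of "-1"]] by simp

lemma sq_integrable_sum: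
  assumes "\<And>i. i \<in> I \<Longrightarrow> sq_integrable M (f i)"
  shows "sq_integrable M (\<lambda>x. \<Sum>i\<in>I. f i x)"
proof (cases "finite I")
  case True
  then show ?thesis using assms
    by (induction I) (simp_all add: sq_integrable_add sq_integrable_def[of M "\<lambda>_. 0"])
qed (simp add: sq_integrable_def)

text \<open>Replaces the triangle inequality, so that squared distances can be used throughout
  without taking roots. The price is the factor 2, which explains the bounds \<epsilon>/4 further
  on: two errors below \<epsilon>/4 combine to less than \<epsilon>.\<close>

lemma integral_square_add_le:
  assumes "sq_integrable M f" "sq_integrable M g"
  shows "(\<integral>x. (f x + g x)\<^sup>2 \<partial>M) \<le> 2 * (\<integral>x. (f x)\<^sup>2 \<partial>M) + 2 * (\<integral>x. (g x)\<^sup>2 \<partial>M)"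
proof -
  have *: "(u + v)\<^sup>2 \<le> 2 * u\<^sup>2 + 2 * v\<^sup>2" for u v :: real
    using zero_le_power2[of "u - v"] by (simp add: power2_sum power2_diff)
  have "(\<integral>x. (f x + g x)\<^sup>2 \<partial>M) \<le> (\<integral>x. 2 * (f x)\<^sup>2 + 2 * (g x)\<^sup>2 \<partial>M)"
    using assms sq_integrable_add[OF assms] *
    by (intro integral_mono) (auto simp: sq_integrable_def)
  also have "\<dots> = 2 * (\<integral>x. (f x)\<^sup>2 \<partial>M) + 2 * (\<integral>x. (g x)\<^sup>2 \<partial>M)"
    using assms by (simp add: sq_integrable_def)
  finally show ?thesis .
qed

lemma sq_integrable_bounded:
  assumes "finite_measure M" "f \<in> borel_measurable M" "\<And>x. x \<in> space M \<Longrightarrow> \<bar>f x\<bar> \<le> B"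
  shows "sq_integrable M f"
proof -
  interpret finite_measure M by fact
  have "integrable M (\<lambda>x. (f x)\<^sup>2)"
  proof (rule integrable_const_bound[of _ "B\<^sup>2"])
    show "AE x in M. norm ((f x)\<^sup>2) \<le> B\<^sup>2"
      using assms(3) by (intro AE_I2) (metis abs_ge_zero norm_power power_mono real_norm_def)
  qed (use assms in measurable)
  then show ?thesis using assms by (simp add: sq_integrable_def)
qed

section \<open>Completeness of L^2 over a finite measure\<close>

lemma Riesz_Fischer:
  fixes F :: "nat \<Rightarrow> 'a \<Rightarrow> real"
  assumes "finite_measure M" and F: "\<And>n. sq_integrable M (F n)"
    and cauchy: "\<And>e. 0 < e \<Longrightarrow> \<exists>N. \<forall>m\<ge>N. \<forall>n\<ge>N. (\<integral>x. (F m x - F n x)\<^sup>2 \<partial>M) < e"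
  obtains f where "sq_integrable M f" "(\<lambda>n. \<integral>x. (F n x - f x)\<^sup>2 \<partial>M) \<longlonglongrightarrow> 0"
proof -
  interpret finite_measure M by fact
  note [measurable] = sq_integrable_measurable[OF F]
  have "\<forall>i. \<exists>N. \<forall>m\<ge>N. \<forall>n\<ge>N. (\<integral>x. (F m x - F n x)\<^sup>2 \<partial>M) < (1/4) ^ i"
    using cauchy by simp
  then obtain N where N: "\<And>i m n. m \<ge> N i \<Longrightarrow> n \<ge> N i \<Longrightarrow> (\<integral>x. (F m x - F n x)\<^sup>2 \<partial>M) < (1/4) ^ i"
    by metis
  \<comment> \<open>The sum makes \<open>r\<close> monotone with \<open>N i \<le> r i\<close>; the
    summand \<open>i\<close> makes \<open>r i\<close> tend to infinity, which the Fatou argument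
    needs.\<close>
  define r where "r i = i + (\<Sum>j\<le>i. N j)" for i
  have rN: "N i \<le> r i" for i
    unfolding r_def by (intro trans_le_add2 member_le_sum) auto
  have rS: "r i \<le> r (Suc i)" for i by (simp add: r_def)
  define d where "d i x = F (r (Suc i)) x - F (r i) x" for i x
  have d: "sq_integrable M (d i)" for i
    unfolding d_def by (intro sq_integrable_diff F)
  note [measurable] = sq_integrable_measurable[OF d]
  have d2: "(\<integral>x. (d i x)\<^sup>2 \<partial>M) < (1/4) ^ i" for i
    unfolding d_def using N[OF order_trans[OF rN rS] rN] .
  define C where "C = (1 + measure M (space M)) / 2"
  have nd: "(\<integral>\<^sup>+x. ennreal \<bar>d i x\<bar> \<partial>M) \<le> ennreal (C * (1/2) ^ i)" for i
  proof -
    \<comment> \<open>AM-GM with weight 2^i balances the two terms: the integral of the square is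
      below 4^-i, so both become of order 2^-i. The constant term is integrable because the measure
      is finite, and this turns L^2 smallness into summable L^1 norms.\<close>
    have pt: "\<bar>d i x\<bar> \<le> (2 ^ i * (d i x)\<^sup>2 + (1/2) ^ i) / 2" for x
    proof -
      have "0 \<le> (2 ^ i * \<bar>d i x\<bar> - 1)\<^sup>2 / 2 ^ i" by simp
      also have "\<dots> = 2 ^ i * (d i x)\<^sup>2 + (1/2) ^ i - 2 * \<bar>d i x\<bar>"
        by (simp add: power2_diff field_simps power2_eq_square)
      finally show ?thesis by simp
    qed
    have "(\<integral>\<^sup>+x. ennreal \<bar>d i x\<bar> \<partial>M) \<le> (\<integral>\<^sup>+x. ennreal ((2 ^ i * (d i x)\<^sup>2 + (1/2) ^ i) / 2) \<partial>M)"
      by (intro nn_integral_mono ennreal_leI pt)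
    also have "\<dots> = ennreal (\<integral>x. (2 ^ i * (d i x)\<^sup>2 + (1/2) ^ i) / 2 \<partial>M)"
      using sq_integrable_square[OF d] by (intro nn_integral_eq_integral) auto
    also have "(\<integral>x. (2 ^ i * (d i x)\<^sup>2 + (1/2) ^ i) / 2 \<partial>M) =
        (2 ^ i * (\<integral>x. (d i x)\<^sup>2 \<partial>M) + (1/2) ^ i * measure M (space M)) / 2"
      using sq_integrable_square[OF d] by simp
    also have "\<dots> \<le> (2 ^ i * (1/4) ^ i + (1/2) ^ i * measure M (space M)) / 2"
      using d2[of i] by (intro divide_right_mono add_mono mult_left_mono) auto
    also have "\<dots> = C * (1/2) ^ i"
      by (simp add: C_def field_simps flip: power_mult_distrib)
    finally show ?thesis by (simp add: ennreal_leI)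
  qed
  have "(\<integral>\<^sup>+x. (\<Sum>i. ennreal \<bar>d i x\<bar>) \<partial>M) = (\<Sum>i. \<integral>\<^sup>+x. ennreal \<bar>d i x\<bar> \<partial>M)"
    by (intro nn_integral_suminf) measurable
  also have "\<dots> \<le> (\<Sum>i. ennreal (C * (1/2) ^ i))"
    by (intro suminf_le nd) auto
  also have "\<dots> = ennreal (\<Sum>i. C * (1/2) ^ i)"
    by (rule suminf_ennreal2) (auto simp: C_def intro!: summable_mult summable_geometric)
  also have "\<dots> < \<infinity>" by simp
  finally have "AE x in M. (\<Sum>i. ennreal \<bar>d i x\<bar>) \<noteq> \<infinity>"
    by (intro nn_integral_noteq_infinite) (auto simp: less_top)
  then have conv: "AE x in M. convergent (\<lambda>i. F (r i) x)"
  proof eventually_elim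
    case (elim x)
    then have "summable (\<lambda>i. \<bar>d i x\<bar>)"
      by (intro summable_suminf_not_top) auto
    then have "summable (\<lambda>i. d i x)" by (rule summable_rabs_cancel)
    then have "convergent (\<lambda>n. F (r 0) x + (\<Sum>i<n. d i x))"
      by (intro convergent_add convergent_const) (simp add: summable_iff_convergent)
    moreover have "F (r 0) x + (\<Sum>i<n. d i x) = F (r n) x" for n
      unfolding d_def by (subst sum_lessThan_telescope) simp
    ultimately show ?case by simp
  qed
  define f where "f x = lim (\<lambda>i. F (r i) x)" for x
  have [measurable]: "f \<in> borel_measurable M"
    unfolding f_def by measurable
  have lim: "AE x in M. (\<lambda>i. F (r i) x) \<longlonglongrightarrow> f x"
    using conv by eventually_elim (simp add: f_def convergent_LIMSEQ_iff)
  \<comment> \<open>The pointwise limit is known only along the subsequence \<open>r\<close>, but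
    Fatou's lemma in the second index carries the Cauchy bound over to every \<open>F n\<close> of
    the full sequence.\<close>
  have fatou: "(\<integral>\<^sup>+x. ennreal ((F n x - f x)\<^sup>2) \<partial>M) \<le> ennreal e"
    if e: "0 < e" and NN: "\<And>m. N' \<le> m \<Longrightarrow> (\<integral>x. (F n x - F m x)\<^sup>2 \<partial>M) < e" for n e N'
  proof -
    have "(\<integral>\<^sup>+x. ennreal ((F n x - f x)\<^sup>2) \<partial>M)
        = (\<integral>\<^sup>+x. liminf (\<lambda>i. ennreal ((F n x - F (r i) x)\<^sup>2)) \<partial>M)"
      using lim
    proof (intro nn_integral_cong_AE, eventually_elim)
      case (elim x)
      then have "(\<lambda>i. ennreal ((F n x - F (r i) x)\<^sup>2)) \<longlonglongrightarrow> ennreal ((F n x - f x)\<^sup>2)"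
        by (intro tendsto_intros tendsto_ennrealI)
      then show ?case by (simp only: lim_imp_Liminf[OF trivial_limit_sequentially])
    qed
    also have "\<dots> \<le> liminf (\<lambda>i. \<integral>\<^sup>+x. ennreal ((F n x - F (r i) x)\<^sup>2) \<partial>M)"
      by (rule nn_integral_liminf) measurable
    also have "\<dots> \<le> liminf (\<lambda>i::nat. ennreal e)"
    proof (rule Liminf_mono, rule eventually_sequentiallyI[of N'])
      fix i assume "N' \<le> i"
      then have "N' \<le> r i" by (simp add: r_def)
      then have "(\<integral>x. (F n x - F (r i) x)\<^sup>2 \<partial>M) < e" by (rule NN)
      then show "(\<integral>\<^sup>+x. ennreal ((F n x - F (r i) x)\<^sup>2) \<partial>M) \<le> ennreal e"
        using sq_integrable_square[OF sq_integrable_diff[OF F F, of n "r i"]]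
        by (subst nn_integral_eq_integral) (auto simp: ennreal_leI)
    qed
    also have "\<dots> = ennreal e" by (simp add: Liminf_const)
    finally show ?thesis .
  qed
  have sqd: "sq_integrable M (\<lambda>x. F n x - f x)"
    if "N (0::nat) \<le> n" for n
  proof -
    have "(\<integral>\<^sup>+x. ennreal ((F n x - f x)\<^sup>2) \<partial>M) \<le> ennreal 1"
      using N[of 0 n] that by (intro fatou[of 1 "N 0"]) auto
    then have "(\<integral>\<^sup>+x. ennreal (norm ((F n x - f x)\<^sup>2)) \<partial>M) < \<infinity>"
      by (simp add: order_le_less_trans)
    then have "integrable M (\<lambda>x. (F n x - f x)\<^sup>2)"
      by (intro integrableI_bounded) measurable
    then show ?thesis by (simp add: sq_integrable_def)
  qed
  have fs: "sq_integrable M f"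
    using sq_integrable_diff[OF F[of "N 0"] sqd[of "N 0"]] by simp
  have "(\<lambda>n. \<integral>x. (F n x - f x)\<^sup>2 \<partial>M) \<longlonglongrightarrow> 0"
  proof (rule LIMSEQ_I)
    fix e :: real assume e: "0 < e"
    then obtain N' where N': "\<And>m n. N' \<le> m \<Longrightarrow> N' \<le> n \<Longrightarrow> (\<integral>x. (F m x - F n x)\<^sup>2 \<partial>M) < e / 2"
      using cauchy[of "e/2"] by auto
    show "\<exists>no. \<forall>n\<ge>no. norm ((\<integral>x. (F n x - f x)\<^sup>2 \<partial>M) - 0) < e"
    proof (intro exI allI impI)
      fix n assume n: "n \<ge> N'"
      have "(\<integral>\<^sup>+x. ennreal ((F n x - f x)\<^sup>2) \<partial>M) \<le> ennreal (e / 2)"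
        using e N' n by (intro fatou[of _ N']) auto
      then have "(\<integral>x. (F n x - f x)\<^sup>2 \<partial>M) \<le> e / 2"
        using sq_integrable_square[OF sq_integrable_diff[OF F fs, of n]] e
        by (subst (asm) nn_integral_eq_integral) auto
      then show "norm ((\<integral>x. (F n x - f x)\<^sup>2 \<partial>M) - 0) < e" using e by simp
    qed
  qed
  with fs that show ?thesis by blast
qed

section \<open>Orthogonal families: best approximation and convergence\<close>

text \<open>Completing the square in each coefficient: the error is least exactly where
  \<open>b i = a i\<close> for the elements of nonzero norm. Bessel's inequality, best approximation
  and Pythagoras are the instances \<open>b = a\<close>, a comparison of two choices of
  \<open>b\<close>, and \<open>g = 0\<close>. The coefficients \<open>a\<close> are given by a
  product rather than a quotient, so elements of norm zero need no separate treatment.\<close>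

lemma integral_square_diff_orthogonal_sum:
  fixes g :: "'a \<Rightarrow> real" and e :: "'i \<Rightarrow> 'a \<Rightarrow> real"
  assumes I: "finite I" and g: "sq_integrable M g" and e: "\<And>i. i \<in> I \<Longrightarrow> sq_integrable M (e i)"
    and orth: "\<And>i j. i \<in> I \<Longrightarrow> j \<in> I \<Longrightarrow> i \<noteq> j \<Longrightarrow> (\<integral>x. e i x * e j x \<partial>M) = 0"
    and a: "\<And>i. i \<in> I \<Longrightarrow> (\<integral>x. g x * e i x \<partial>M) = a i * (\<integral>x. (e i x)\<^sup>2 \<partial>M)"
  shows "(\<integral>x. (g x - (\<Sum>i\<in>I. b i * e i x))\<^sup>2 \<partial>M) =
    (\<integral>x. (g x)\<^sup>2 \<partial>M) + (\<Sum>i\<in>I. ((b i - a i)\<^sup>2 - (a i)\<^sup>2) * (\<integral>x. (e i x)\<^sup>2 \<partial>M))"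
proof -
  let ?w = "\<lambda>i. \<integral>x. (e i x)\<^sup>2 \<partial>M"
  have ge: "integrable M (\<lambda>x. g x * e i x)" if "i \<in> I" for i
    using sq_integrable_times[OF g e[OF that]] .
  have ee: "integrable M (\<lambda>x. e i x * e j x)" if "i \<in> I" "j \<in> I" for i j
    using sq_integrable_times[OF e e] that .
  have "(\<integral>x. (g x - (\<Sum>i\<in>I. b i * e i x))\<^sup>2 \<partial>M) =
    (\<integral>x. (g x)\<^sup>2 - 2 * (\<Sum>i\<in>I. b i * (g x * e i x)) + (\<Sum>i\<in>I. \<Sum>j\<in>I. b i * b j * (e i x * e j x)) \<partial>M)"
  proof (rule Bochner_Integration.integral_cong[OF refl])
    fix x
    have "(\<Sum>i\<in>I. b i * e i x)\<^sup>2 = (\<Sum>i\<in>I. \<Sum>j\<in>I. b i * b j * (e i x * e j x))"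
      unfolding power2_eq_square sum_product by (intro sum.cong refl) (simp add: mult_ac)
    moreover have "g x * (\<Sum>i\<in>I. b i * e i x) = (\<Sum>i\<in>I. b i * (g x * e i x))"
      by (simp add: sum_distrib_left mult_ac)
    ultimately show "(g x - (\<Sum>i\<in>I. b i * e i x))\<^sup>2 = (g x)\<^sup>2 - 2 * (\<Sum>i\<in>I. b i * (g x * e i x)) + (\<Sum>i\<in>I. \<Sum>j\<in>I. b i * b j * (e i x * e j x))"
      by (simp add: power2_diff)
  qed
  also have "\<dots> = (\<integral>x. (g x)\<^sup>2 \<partial>M) - 2 * (\<Sum>i\<in>I. b i * (\<integral>x. g x * e i x \<partial>M))
      + (\<Sum>i\<in>I. \<Sum>j\<in>I. b i * b j * (\<integral>x. e i x * e j x \<partial>M))"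
    using ge ee sq_integrable_square[OF g] by simp
  also have "(\<Sum>i\<in>I. \<Sum>j\<in>I. b i * b j * (\<integral>x. e i x * e j x \<partial>M)) = (\<Sum>i\<in>I. (b i)\<^sup>2 * ?w i)"
  proof (rule sum.cong[OF refl])
    fix i assume i: "i \<in> I"
    have "(\<Sum>j\<in>I. b i * b j * (\<integral>x. e i x * e j x \<partial>M)) = (\<Sum>j\<in>{i}. b i * b j * (\<integral>x. e i x * e j x \<partial>M))"
      using i I by (intro sum.mono_neutral_right) (auto simp: orth)
    then show "(\<Sum>j\<in>I. b i * b j * (\<integral>x. e i x * e j x \<partial>M)) = (b i)\<^sup>2 * ?w i"
      by (simp add: power2_eq_square)
  qed
  also have "(\<Sum>i\<in>I. b i * (\<integral>x. g x * e i x \<partial>M)) = (\<Sum>i\<in>I. b i * a i * ?w i)"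
    by (intro sum.cong refl) (simp add: a)
  also have "(\<Sum>i\<in>I. (b i)\<^sup>2 * ?w i) = 2 * (\<Sum>i\<in>I. b i * a i * ?w i) + (\<Sum>i\<in>I. ((b i - a i)\<^sup>2 - (a i)\<^sup>2) * ?w i)"
    unfolding sum_distrib_left sum.distrib[symmetric]
    by (intro sum.cong refl) (simp add: power2_eq_square algebra_simps)
  finally show ?thesis by simp
qed

lemma orthogonal_best_approximation:
  fixes g :: "'a \<Rightarrow> real" and e :: "'i \<Rightarrow> 'a \<Rightarrow> real"
  assumes "finite I" "sq_integrable M g" "\<And>i. i \<in> I \<Longrightarrow> sq_integrable M (e i)"
    and "\<And>i j. i \<in> I \<Longrightarrow> j \<in> I \<Longrightarrow> i \<noteq> j \<Longrightarrow> (\<integral>x. e i x * e j x \<partial>M) = 0"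
    and "\<And>i. i \<in> I \<Longrightarrow> (\<integral>x. g x * e i x \<partial>M) = a i * (\<integral>x. (e i x)\<^sup>2 \<partial>M)"
  shows "(\<integral>x. (g x - (\<Sum>i\<in>I. a i * e i x))\<^sup>2 \<partial>M) \<le> (\<integral>x. (g x - (\<Sum>i\<in>I. b i * e i x))\<^sup>2 \<partial>M)"
proof -
  have "(\<integral>x. (g x - (\<Sum>i\<in>I. c i * e i x))\<^sup>2 \<partial>M) =
    (\<integral>x. (g x)\<^sup>2 \<partial>M) + (\<Sum>i\<in>I. ((c i - a i)\<^sup>2 - (a i)\<^sup>2) * (\<integral>x. (e i x)\<^sup>2 \<partial>M))" (is "?L c = ?R c") for c
    by (rule integral_square_diff_orthogonal_sum) (use assms in auto)
  moreover have "?R a \<le> ?R b"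
    by (intro add_left_mono sum_mono mult_right_mono) auto
  ultimately show ?thesis by simp
qed

lemma Bessel_inequality:
  fixes g :: "'a \<Rightarrow> real" and e :: "'i \<Rightarrow> 'a \<Rightarrow> real"
  assumes "finite I" "sq_integrable M g" "\<And>i. i \<in> I \<Longrightarrow> sq_integrable M (e i)"
    and "\<And>i j. i \<in> I \<Longrightarrow> j \<in> I \<Longrightarrow> i \<noteq> j \<Longrightarrow> (\<integral>x. e i x * e j x \<partial>M) = 0"
    and "\<And>i. i \<in> I \<Longrightarrow> (\<integral>x. g x * e i x \<partial>M) = a i * (\<integral>x. (e i x)\<^sup>2 \<partial>M)"
  shows "(\<Sum>i\<in>I. (a i)\<^sup>2 * (\<integral>x. (e i x)\<^sup>2 \<partial>M)) \<le> (\<integral>x. (g x)\<^sup>2 \<partial>M)"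
proof -
  have "0 \<le> (\<integral>x. (g x - (\<Sum>i\<in>I. a i * e i x))\<^sup>2 \<partial>M)" by simp
  also have "\<dots> = (\<integral>x. (g x)\<^sup>2 \<partial>M) + (\<Sum>i\<in>I. ((a i - a i)\<^sup>2 - (a i)\<^sup>2) * (\<integral>x. (e i x)\<^sup>2 \<partial>M))"
    by (rule integral_square_diff_orthogonal_sum) (use assms in auto)
  finally show ?thesis by (simp add: sum_negf)
qed

text \<open>By Bessel the squared lengths of the terms are summable, and their partial sums measure
  the distances between partial sums of the series. The limit is in general not \<open>g\<close>,
  since the family need not be complete; for the half disk it will be the part of \<gamma> belonging
  to a single k.\<close>

lemma orthogonal_series_converges:
  fixes g :: "'a \<Rightarrow> real" and e :: "nat \<Rightarrow> 'a \<Rightarrow> real"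
  assumes M: "finite_measure M" and g: "sq_integrable M g" and e: "\<And>i. sq_integrable M (e i)"
    and orth: "\<And>i j. i \<noteq> j \<Longrightarrow> (\<integral>x. e i x * e j x \<partial>M) = 0"
    and a: "\<And>i. (\<integral>x. g x * e i x \<partial>M) = a i * (\<integral>x. (e i x)\<^sup>2 \<partial>M)"
  obtains f where "sq_integrable M f" "(\<lambda>n. \<integral>x. ((\<Sum>i<n. a i * e i x) - f x)\<^sup>2 \<partial>M) \<longlonglongrightarrow> 0"
proof -
  let ?t = "\<lambda>i. (a i)\<^sup>2 * (\<integral>x. (e i x)\<^sup>2 \<partial>M)"
  have "summable ?t"
  proof (rule summableI_nonneg_bounded)
    show "sum ?t {..<n} \<le> (\<integral>x. (g x)\<^sup>2 \<partial>M)" for n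
      by (rule Bessel_inequality) (auto simp: g e orth a)
  qed simp
  then have cs: "Cauchy (\<lambda>n. sum ?t {..<n})"
    by (simp add: summable_iff_convergent Cauchy_convergent_iff)
  let ?F = "\<lambda>n x. \<Sum>i<n. a i * e i x"
  have F: "sq_integrable M (?F n)" for n
    by (intro sq_integrable_sum sq_integrable_cmult e)
  have eq: "(\<integral>x. (?F n x - ?F m x)\<^sup>2 \<partial>M) = sum ?t {..<n} - sum ?t {..<m}" if "m \<le> n" for m n
  proof -
    have "?F n x - ?F m x = (\<Sum>i\<in>{m..<n}. a i * e i x)" for x
      using that by (simp add: lessThan_atLeast0 sum_diff_nat_ivl)
    then have "(\<integral>x. (?F n x - ?F m x)\<^sup>2 \<partial>M) = (\<integral>x. (0 - (\<Sum>i\<in>{m..<n}. a i * e i x))\<^sup>2 \<partial>M)"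
      by simp
    \<comment> \<open>Pythagoras, as the expansion of the error for the zero function: its Fourier
      coefficients vanish and the coefficients subtracted are \<open>a\<close>.\<close>
    also have "\<dots> = sum ?t {m..<n}"
      using integral_square_diff_orthogonal_sum[where I = "{m..<n}" and M = M and g = "\<lambda>_. 0" and e = e and a = "\<lambda>_. 0" and b = a]
      by (simp add: e orth sq_integrable_def[of M "\<lambda>_. 0"])
    also have "\<dots> = sum ?t {..<n} - sum ?t {..<m}"
      using that by (simp add: lessThan_atLeast0 sum_diff_nat_ivl)
    finally show ?thesis .
  qed
  have eq': "(\<integral>x. (?F n x - ?F m x)\<^sup>2 \<partial>M) = \<bar>sum ?t {..<n} - sum ?t {..<m}\<bar>" for m n
  proof (cases "m \<le> n")
    case True
    have "0 \<le> (\<integral>x. (?F n x - ?F m x)\<^sup>2 \<partial>M)" by simp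
    then show ?thesis using eq[OF True] by simp
  next
    case False
    then have "n \<le> m" by simp
    have "0 \<le> (\<integral>x. (?F m x - ?F n x)\<^sup>2 \<partial>M)" by simp
    then show ?thesis using eq[OF \<open>n \<le> m\<close>] by (simp add: power2_commute)
  qed
  show ?thesis
  proof (rule Riesz_Fischer[of M ?F, OF M F _ that])
    fix \<epsilon> :: real assume "0 < \<epsilon>"
    then show "\<exists>N. \<forall>m\<ge>N. \<forall>n\<ge>N. (\<integral>x. (?F m x - ?F n x)\<^sup>2 \<partial>M) < \<epsilon>"
      using cs unfolding eq' Cauchy_iff real_norm_def by blast
  qed
qed

text \<open>Any good finite combination lies in some rectangle of indices, and the Fourier sum over
  a larger rectangle is at least as good. This bound holds for all widths \<open>N\<close> at once,
  so for each fixed \<open>K\<close> the width may be chosen afterwards, large enough for the rows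
  up to \<open>K\<close> to be near their limits.\<close>

lemma orthogonal_double_series:
  fixes g :: "'a \<Rightarrow> real" and e :: "nat \<Rightarrow> nat \<Rightarrow> 'a \<Rightarrow> real"
  assumes M: "finite_measure M" and g: "sq_integrable M g" and e: "\<And>k n. sq_integrable M (e k n)"
    and orth: "\<And>k n k' n'. (k, n) \<noteq> (k', n') \<Longrightarrow> (\<integral>x. e k n x * e k' n' x \<partial>M) = 0"
    and a: "\<And>k n. (\<integral>x. g x * e k n x \<partial>M) = a k n * (\<integral>x. (e k n x)\<^sup>2 \<partial>M)"
    and dense: "\<And>\<epsilon>. 0 < \<epsilon> \<Longrightarrow> \<exists>I b. finite I \<and> (\<integral>x. (g x - (\<Sum>(k, n)\<in>I. b (k, n) * e k n x))\<^sup>2 \<partial>M) < \<epsilon>"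
  obtains S where "\<And>k. sq_integrable M (S k)"
    "\<And>k. (\<lambda>N. \<integral>x. ((\<Sum>n<N. a k n * e k n x) - S k x)\<^sup>2 \<partial>M) \<longlonglongrightarrow> 0"
    "(\<lambda>K. \<integral>x. ((\<Sum>k\<le>K. S k x) - g x)\<^sup>2 \<partial>M) \<longlonglongrightarrow> 0"
proof -
  let ?P = "\<lambda>k N x. \<Sum>n<N. a k n * e k n x"
  have P: "sq_integrable M (?P k N)" for k N
    by (intro sq_integrable_sum sq_integrable_cmult e)
  have "\<forall>k. \<exists>f. sq_integrable M f \<and> (\<lambda>N. \<integral>x. (?P k N x - f x)\<^sup>2 \<partial>M) \<longlonglongrightarrow> 0"
  proof
    fix k
    have "(\<integral>x. e k i x * e k j x \<partial>M) = 0" if "i \<noteq> j" for i j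
      using that by (intro orth) simp
    then obtain f where "sq_integrable M f" "(\<lambda>N. \<integral>x. (?P k N x - f x)\<^sup>2 \<partial>M) \<longlonglongrightarrow> 0"
      by (rule orthogonal_series_converges[OF M g e _ a])
    then show "\<exists>f. sq_integrable M f \<and> (\<lambda>N. \<integral>x. (?P k N x - f x)\<^sup>2 \<partial>M) \<longlonglongrightarrow> 0"
      by (intro exI conjI)
  qed
  from choice[OF this] obtain S where S: "\<And>k. sq_integrable M (S k)"
    and SP: "\<And>k. (\<lambda>N. \<integral>x. (?P k N x - S k x)\<^sup>2 \<partial>M) \<longlonglongrightarrow> 0"
    by blast
  let ?T = "\<lambda>K x. \<Sum>k\<le>K. S k x"
  let ?D = "\<lambda>K N x. \<Sum>k\<le>K. ?P k N x"
  have T: "sq_integrable M (?T K)" for K by (intro sq_integrable_sum S)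
  have D: "sq_integrable M (?D K N)" for K N by (intro sq_integrable_sum P)
  have DT: "(\<lambda>N. \<integral>x. (?D K N x - ?T K x)\<^sup>2 \<partial>M) \<longlonglongrightarrow> 0" for K
  proof (induction K)
    case 0
    then show ?case using SP[of 0] by simp
  next
    case (Suc K)
    have bd: "(\<integral>x. (?D (Suc K) N x - ?T (Suc K) x)\<^sup>2 \<partial>M)
       \<le> 2 * (\<integral>x. (?D K N x - ?T K x)\<^sup>2 \<partial>M) + 2 * (\<integral>x. (?P (Suc K) N x - S (Suc K) x)\<^sup>2 \<partial>M)" for N
      using integral_square_add_le[OF sq_integrable_diff[OF D[where K = K and N = N] T[of K]] sq_integrable_diff[OF P[of "Suc K" N] S[of "Suc K"]]]
      by (simp add: add_diff_add)
    have lim: "(\<lambda>N. 2 * (\<integral>x. (?D K N x - ?T K x)\<^sup>2 \<partial>M) + 2 * (\<integral>x. (?P (Suc K) N x - S (Suc K) x)\<^sup>2 \<partial>M)) \<longlonglongrightarrow> 2 * 0 + 2 * 0"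
      by (intro tendsto_intros Suc.IH SP)
    show ?case
      by (rule tendsto_sandwich[OF _ _ tendsto_const lim[simplified]])
        (use bd in \<open>auto intro!: always_eventually simp del: sum.atMost_Suc\<close>)
  qed
  have "(\<lambda>K. \<integral>x. (?T K x - g x)\<^sup>2 \<partial>M) \<longlonglongrightarrow> 0"
  proof (rule LIMSEQ_I)
    fix \<epsilon> :: real assume \<epsilon>: "0 < \<epsilon>"
    obtain I b where I: "finite I" and Ib: "(\<integral>x. (g x - (\<Sum>(k, n)\<in>I. b (k, n) * e k n x))\<^sup>2 \<partial>M) < \<epsilon> / 4"
      using dense[of "\<epsilon> / 4"] \<epsilon> by auto
    \<comment> \<open>Exceeds both components of every index in \<open>I\<close>, so that
      \<open>I\<close> fits into each rectangle considered below; the missing coefficients are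
      filled up with zeros.\<close>
    define N0 where "N0 = Suc (\<Sum>i\<in>I. fst i + snd i)"
    have IN: "fst i < N0" "snd i < N0" if "i \<in> I" for i
      using member_le_sum[OF that, of "\<lambda>i. fst i + snd i"] I by (auto simp: N0_def)
    have best: "(\<integral>x. (g x - ?D K N x)\<^sup>2 \<partial>M) < \<epsilon> / 4" if "K \<ge> N0" "N \<ge> N0" for K N
    proof -
      let ?J = "{..K} \<times> {..<N}"
      have IJ: "I \<subseteq> ?J" using IN that by force
      define b' where "b' i = (if i \<in> I then b i else 0)" for i
      have "(\<Sum>i\<in>I. b i * e (fst i) (snd i) x) = (\<Sum>i\<in>?J. b' i * e (fst i) (snd i) x)" for x
        using IJ by (intro sum.mono_neutral_cong_left) (auto simp: b'_def)
      moreover have "?D K N x = (\<Sum>i\<in>?J. a (fst i) (snd i) * e (fst i) (snd i) x)" for x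
        by (simp add: sum.cartesian_product case_prod_unfold)
      moreover have "(\<integral>x. (g x - (\<Sum>i\<in>?J. a (fst i) (snd i) * e (fst i) (snd i) x))\<^sup>2 \<partial>M)
         \<le> (\<integral>x. (g x - (\<Sum>i\<in>?J. b' i * e (fst i) (snd i) x))\<^sup>2 \<partial>M)"
        by (rule orthogonal_best_approximation) (auto simp: g e a intro!: orth)
      ultimately show ?thesis using Ib by (simp add: case_prod_unfold)
    qed
    show "\<exists>no. \<forall>K\<ge>no. norm ((\<integral>x. (?T K x - g x)\<^sup>2 \<partial>M) - 0) < \<epsilon>"
    proof (intro exI allI impI)
      fix K assume K: "K \<ge> N0"
      \<comment> \<open>\<open>N1\<close> depends on \<open>K\<close>, while \<open>N0\<close> does
        not; only the latter enters the final threshold for \<open>K\<close>.\<close>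
      obtain N1 where N1: "\<And>N. N \<ge> N1 \<Longrightarrow> (\<integral>x. (?D K N x - ?T K x)\<^sup>2 \<partial>M) < \<epsilon> / 4"
        using LIMSEQ_D[OF DT[of K], of "\<epsilon> / 4"] \<epsilon> by auto
      define N where "N = max N0 N1"
      have "(\<integral>x. (?T K x - g x)\<^sup>2 \<partial>M) = (\<integral>x. ((g x - ?D K N x) + (?D K N x - ?T K x))\<^sup>2 \<partial>M)"
        by (simp add: power2_commute)
      also have "\<dots> \<le> 2 * (\<integral>x. (g x - ?D K N x)\<^sup>2 \<partial>M) + 2 * (\<integral>x. (?D K N x - ?T K x)\<^sup>2 \<partial>M)"
        by (intro integral_square_add_le sq_integrable_diff g D T)
      also have "\<dots> < 2 * (\<epsilon> / 4) + 2 * (\<epsilon> / 4)"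
        using best[OF K, of N] N1[of N] by (intro add_strict_mono) (auto simp: N_def)
      finally show "norm ((\<integral>x. (?T K x - g x)\<^sup>2 \<partial>M) - 0) < \<epsilon>" by simp
    qed
  qed
  from that[OF S SP this] show ?thesis .
qed

section \<open>Moments of the half disk\<close>

definition cpx :: "real \<times> real \<Rightarrow> complex" where
  "cpx p = Complex (fst p) (snd p)"

lemma norm_cpx [simp]: "norm (cpx p) = norm p"
  by (simp add: cpx_def complex_norm norm_prod_def)

lemma bounded_linear_cpx: "bounded_linear cpx"
proof
  show "cpx (p + q) = cpx p + cpx q" for p q by (simp add: cpx_def complex_eq_iff)
  show "cpx (r *\<^sub>R p) = r *\<^sub>R cpx p" for r p by (simp add: cpx_def complex_eq_iff)
  show "\<exists>K. \<forall>x. norm (cpx x) \<le> norm x * K" by (intro exI[of _ 1]) simp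
qed

lemma continuous_on_cpx [continuous_intros]: "continuous_on A cpx"
  by (rule bounded_linear.continuous_on[OF bounded_linear_cpx continuous_on_id])

text \<open>In polar form r^(a+b) times cis ((a-b) phi): a rotation acts on it by a scalar, and
  conjugation exchanges the exponents. As a polynomial in the coordinates it is continuous on the
  whole plane, with no trouble from the branch cut of \<open>Arg\<close>.\<close>

definition zmono :: "nat \<Rightarrow> nat \<Rightarrow> real \<times> real \<Rightarrow> complex" where
  "zmono a b p = cpx p ^ a * cnj (cpx p) ^ b"

lemma continuous_on_zmono [continuous_intros]: "continuous_on A (zmono a b)"
  unfolding zmono_def by (intro continuous_intros)

lemma measurable_zmono [measurable]: "zmono a b \<in> borel_measurable borel"
  by (rule borel_measurable_continuous_onI) (rule continuous_on_zmono)

lemma half_disk_eq: "half_disk = ball 0 1 \<inter> {p. 0 < snd p}"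
proof -
  have "norm p < 1 \<longleftrightarrow> (fst p)\<^sup>2 + (snd p)\<^sup>2 < 1" for p :: "real \<times> real"
    by (simp add: norm_prod_def)
  then show ?thesis by (auto simp: half_disk_def)
qed

lemma open_half_disk: "open half_disk"
  unfolding half_disk_eq by (intro open_Int open_ball open_Collect_less continuous_intros)

section \<open>Measure-preserving shears, reflection and rotations\<close>

lemma distr_lborel_fst_affine:
  fixes s :: "real \<Rightarrow> real"
  assumes [measurable]: "s \<in> borel_measurable borel" and c: "\<bar>c\<bar> = 1"
  shows "distr lborel borel (\<lambda>p. (s (snd p) + c * fst p, snd p)) = lborel"
proof (rule measure_eqI)
  fix A :: "(real \<times> real) set" assume "A \<in> sets (distr lborel borel (\<lambda>p. (s (snd p) + c * fst p, snd p)))"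
  then have A: "A \<in> sets borel" by simp
  then have [measurable]: "A \<in> sets (borel \<Otimes>\<^sub>M borel)" by (simp flip: borel_prod)
  have T: "(\<lambda>p. (s (snd p) + c * fst p, snd p)) \<in> measurable (lborel \<Otimes>\<^sub>M lborel) (borel \<Otimes>\<^sub>M borel)"
    by measurable
  have "emeasure (distr lborel borel (\<lambda>p. (s (snd p) + c * fst p, snd p))) A
     = (\<integral>\<^sup>+p. indicator A p \<partial>distr lborel borel (\<lambda>p. (s (snd p) + c * fst p, snd p)))"
    by (simp add: A)
  also have "\<dots> = (\<integral>\<^sup>+p. indicator A (s (snd p) + c * fst p, snd p) \<partial>(lborel \<Otimes>\<^sub>M lborel))"
    using T borel_measurable_indicator[OF A] by (subst nn_integral_distr) (simp_all add: lborel_prod borel_prod)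
  also have "\<dots> = (\<integral>\<^sup>+y. \<integral>\<^sup>+x. indicator A (s y + c * x, y) \<partial>lborel \<partial>lborel)"
    by (subst lborel_pair.nn_integral_snd[symmetric]) auto
  also have "\<dots> = (\<integral>\<^sup>+y. \<integral>\<^sup>+x. indicator A (x, y) \<partial>lborel \<partial>lborel)"
  proof (rule nn_integral_cong)
    fix y
    have "(\<integral>\<^sup>+x. indicator A (x, y) \<partial>lborel) = ennreal \<bar>c\<bar> * (\<integral>\<^sup>+x. indicator A (s y + c * x, y) \<partial>lborel)"
      using c by (intro nn_integral_real_affine) auto
    then show "(\<integral>\<^sup>+x. indicator A (s y + c * x, y) \<partial>lborel) = (\<integral>\<^sup>+x. indicator A (x, y) \<partial>lborel)"
      using c by simp
  qed
  also have "\<dots> = (\<integral>\<^sup>+p. indicator A p \<partial>(lborel \<Otimes>\<^sub>M lborel))"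
    by (subst lborel_pair.nn_integral_snd[symmetric]) auto
  also have "\<dots> = emeasure lborel A"
    by (simp add: lborel_prod A)
  finally show "emeasure (distr lborel borel (\<lambda>p. (s (snd p) + c * fst p, snd p))) A = emeasure lborel A" .
qed simp

text \<open>Besides shears (\<open>c = 1\<close>) this covers the reflection in the x-axis
  (\<open>s = 0\<close>, \<open>c = -1\<close>), which relates the half disk to the full
  disk.\<close>

lemma distr_lborel_snd_affine:
  fixes s :: "real \<Rightarrow> real"
  assumes [measurable]: "s \<in> borel_measurable borel" and c: "\<bar>c\<bar> = 1"
  shows "distr lborel borel (\<lambda>p. (fst p, s (fst p) + c * snd p)) = lborel"
proof (rule measure_eqI)
  fix A :: "(real \<times> real) set" assume "A \<in> sets (distr lborel borel (\<lambda>p. (fst p, s (fst p) + c * snd p)))"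
  then have A: "A \<in> sets borel" by simp
  then have [measurable]: "A \<in> sets (borel \<Otimes>\<^sub>M borel)" by (simp flip: borel_prod)
  have T: "(\<lambda>p. (fst p, s (fst p) + c * snd p)) \<in> measurable (lborel \<Otimes>\<^sub>M lborel) (borel \<Otimes>\<^sub>M borel)"
    by measurable
  have "emeasure (distr lborel borel (\<lambda>p. (fst p, s (fst p) + c * snd p))) A
     = (\<integral>\<^sup>+p. indicator A p \<partial>distr lborel borel (\<lambda>p. (fst p, s (fst p) + c * snd p)))"
    by (simp add: A)
  also have "\<dots> = (\<integral>\<^sup>+p. indicator A (fst p, s (fst p) + c * snd p) \<partial>(lborel \<Otimes>\<^sub>M lborel))"
    using T borel_measurable_indicator[OF A] by (subst nn_integral_distr) (simp_all add: lborel_prod borel_prod)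
  also have "\<dots> = (\<integral>\<^sup>+x. \<integral>\<^sup>+y. indicator A (x, s x + c * y) \<partial>lborel \<partial>lborel)"
    by (subst lborel.nn_integral_fst[symmetric]) auto
  also have "\<dots> = (\<integral>\<^sup>+x. \<integral>\<^sup>+y. indicator A (x, y) \<partial>lborel \<partial>lborel)"
  proof (rule nn_integral_cong)
    fix x
    have "(\<integral>\<^sup>+y. indicator A (x, y) \<partial>lborel) = ennreal \<bar>c\<bar> * (\<integral>\<^sup>+y. indicator A (x, s x + c * y) \<partial>lborel)"
      using c by (intro nn_integral_real_affine) auto
    then show "(\<integral>\<^sup>+y. indicator A (x, s x + c * y) \<partial>lborel) = (\<integral>\<^sup>+y. indicator A (x, y) \<partial>lborel)"
      using c by simp
  qed
  also have "\<dots> = (\<integral>\<^sup>+p. indicator A p \<partial>(lborel \<Otimes>\<^sub>M lborel))"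
    by (subst lborel.nn_integral_fst[symmetric]) auto
  also have "\<dots> = emeasure lborel A"
    by (simp add: lborel_prod A)
  finally show "emeasure (distr lborel borel (\<lambda>p. (fst p, s (fst p) + c * snd p))) A = emeasure lborel A" .
qed simp

definition rotation :: "real \<Rightarrow> real \<times> real \<Rightarrow> real \<times> real" where
  "rotation \<alpha> p = (cos \<alpha> * fst p - sin \<alpha> * snd p, sin \<alpha> * fst p + cos \<alpha> * snd p)"

lemma cpx_rotation: "cpx (rotation \<alpha> p) = cis \<alpha> * cpx p"
  by (simp add: cpx_def rotation_def complex_eq_iff)

lemma norm_rotation: "norm (rotation \<alpha> p) = norm p"
  by (metis cpx_rotation norm_cpx norm_mult norm_cis mult_1)

text \<open>A rotation is a product of three shears, each of which preserves the measure by Fubini.\<close>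

lemma distr_lborel_rotation:
  assumes "cos \<alpha> \<noteq> -1"
  shows "distr lborel borel (rotation \<alpha>) = lborel"
proof -
  \<comment> \<open>This is tan (\<alpha>/2), the slope of the outer two shears; the half turn,
    where it is infinite, is excluded by the assumption.\<close>
  define \<tau> where "\<tau> = sin \<alpha> / (1 + cos \<alpha>)"
  define f where "f = (\<lambda>p::real\<times>real. (- \<tau> * snd p + 1 * fst p, snd p))"
  define g where "g = (\<lambda>p::real\<times>real. (fst p, sin \<alpha> * fst p + 1 * snd p))"
  have nz: "1 + cos \<alpha> \<noteq> 0" using assms by linarith
  have [measurable]: "f \<in> borel_measurable borel" "g \<in> borel_measurable borel"
    unfolding f_def g_def by (simp_all add: borel_prod[symmetric])
  have f: "distr lborel borel f = lborel" and g: "distr lborel borel g = lborel"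
    unfolding f_def g_def by (rule distr_lborel_fst_affine distr_lborel_snd_affine; simp)+
  have 1: "\<tau> * sin \<alpha> = 1 - cos \<alpha>"
  proof -
    have "sin \<alpha> * sin \<alpha> = (1 - cos \<alpha>) * (1 + cos \<alpha>)"
      using sin_squared_eq[of \<alpha>] by (simp add: power2_eq_square algebra_simps)
    then show ?thesis using nz by (simp add: \<tau>_def)
  qed
  have 2: "\<tau> * (1 + cos \<alpha>) = sin \<alpha>" using nz by (simp add: \<tau>_def)
  have fgf: "rotation \<alpha> = f \<circ> (g \<circ> f)"
  proof (rule ext)
    fix p
    have "fst (f (g (f p))) = fst p * (1 - \<tau> * sin \<alpha>) - snd p * (\<tau> * (1 + (1 - \<tau> * sin \<alpha>)))"
      by (simp add: f_def g_def algebra_simps)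
    then have "fst (f (g (f p))) = fst p * cos \<alpha> - snd p * sin \<alpha>"
      by (simp add: 1 2)
    moreover have "snd (f (g (f p))) = sin \<alpha> * fst p + snd p * (1 - \<tau> * sin \<alpha>)"
      by (simp add: f_def g_def algebra_simps)
    ultimately show "rotation \<alpha> p = (f \<circ> (g \<circ> f)) p"
      by (simp add: rotation_def prod_eq_iff 1 mult.commute)
  qed
  have "distr lborel borel (rotation \<alpha>) = distr (distr (distr lborel borel f) borel g) borel f"
    unfolding fgf by (subst distr_distr, simp, simp)+ (simp add: comp_assoc)
  then show ?thesis by (simp add: f g)
qed

lemma integrable_indicator_continuous:
  fixes f :: "real \<times> real \<Rightarrow> 'b::euclidean_space"
  assumes "A \<in> sets borel" "bounded A" "continuous_on UNIV f"
  shows "integrable lborel (\<lambda>p. indicator A p *\<^sub>R f p)"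
proof -
  obtain r where r: "A \<subseteq> cball 0 r"
    using bounded_subset_ballD[OF assms(2), of 0] ball_subset_cball by fastforce
  have "set_integrable lborel (cball 0 r) f"
    unfolding set_integrable_def
    by (intro borel_integrable_compact continuous_on_subset[OF assms(3)]) auto
  then have "set_integrable lborel A f"
    by (rule set_integrable_subset) (use assms r in auto)
  then show ?thesis by (simp add: set_integrable_def)
qed

text \<open>A rotation of the disk multiplies the integrand by a constant different from 1 and
  leaves the integral unchanged.\<close>

lemma integral_disk_zmono_eq_0:
  assumes "a \<noteq> b"
  shows "(\<integral>p. indicator (ball 0 1) p *\<^sub>R zmono a b p \<partial>lborel) = 0" (is "?J = 0")
proof -
  \<comment> \<open>With this angle the constant is \<open>cis 1\<close> for all exponents, and
    |\<alpha>| \<le> 1 < pi/2 keeps \<open>cos \<alpha>\<close> positive, as the decomposition into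
    shears requires.\<close>
  define \<alpha> where "\<alpha> = 1 / (real a - real b)"
  have "1 \<le> \<bar>real a - real b\<bar>" using assms by linarith
  then have "\<bar>\<alpha>\<bar> \<le> 1" by (simp add: \<alpha>_def divide_le_eq)
  then have "cos \<alpha> > 0"
    using pi_gt3 by (intro cos_gt_zero_pi) auto
  then have R: "distr lborel borel (rotation \<alpha>) = lborel"
    by (intro distr_lborel_rotation) auto
  have [measurable]: "ball (0::real\<times>real) 1 \<in> sets borel" by simp
  have [measurable]: "rotation \<alpha> \<in> borel_measurable borel"
    unfolding rotation_def by (simp add: borel_prod[symmetric])
  have rot: "zmono a b (rotation \<alpha> p) = cis 1 * zmono a b p" for p
  proof -
    have "cis \<alpha> ^ a * cnj (cis \<alpha>) ^ b = cis (real a * \<alpha> - real b * \<alpha>)"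
      unfolding cis_cnj Complex.DeMoivre cis_mult by simp
    also have "real a * \<alpha> - real b * \<alpha> = 1"
      using assms by (simp add: \<alpha>_def flip: diff_divide_distrib)
    finally show ?thesis
      by (simp add: zmono_def cpx_rotation power_mult_distrib mult_ac)
  qed
  have "?J = (\<integral>p. indicator (ball 0 1) p *\<^sub>R zmono a b p \<partial>distr lborel borel (rotation \<alpha>))"
    by (simp add: R)
  also have "\<dots> = (\<integral>p. indicator (ball 0 1) (rotation \<alpha> p) *\<^sub>R zmono a b (rotation \<alpha> p) \<partial>lborel)"
    by (intro integral_distr) auto
  also have "\<dots> = (\<integral>p. cis 1 * (indicator (ball 0 1) p *\<^sub>R zmono a b p) \<partial>lborel)"
    by (intro Bochner_Integration.integral_cong) (auto simp: rot norm_rotation indicator_def)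
  also have "\<dots> = cis 1 * ?J" by (rule integral_mult_right_zero)
  finally have "(1 - cis 1) * ?J = 0" by (simp add: algebra_simps)
  moreover have "cis 1 \<noteq> 1"
    using sin_gt_zero[of 1] pi_gt3 by (auto simp: complex_eq_iff)
  ultimately show ?thesis by simp
qed

section \<open>Radial and mixed moments of the disk\<close>

lemma emeasure_disk: "0 \<le> t \<Longrightarrow> emeasure lborel (ball (0::real\<times>real) t) = ennreal (pi * t\<^sup>2)"
  by (simp add: emeasure_ball unit_ball_vol_2 power2_eq_square)

lemma nn_integral_disk_norm_power:
  "(\<integral>\<^sup>+p. ennreal (norm p ^ (2 * a)) * indicator (ball (0::real\<times>real) 1) p \<partial>lborel) = ennreal (pi / (real a + 1))"
proof (cases "a = 0")
  \<comment> \<open>Split off because the truncated exponent \<open>2 * a - 1\<close> has its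
    intended value only for positive \<open>a\<close>.\<close>
  case True
  then show ?thesis by (simp add: emeasure_disk)
next
  case False
  \<comment> \<open>Layer cake: \<open>1 - r ^ (2 * a)\<close> is the integral of \<open>w\<close> over \<open>{r..1}\<close>.\<close>
  let ?B = "ball (0::real\<times>real) 1"
  have [measurable]: "?B \<in> sets borel" by simp
  define w where "w t = 2 * real a * t ^ (2 * a - 1)" for t :: real
  have [measurable]: "w \<in> borel_measurable borel"
    unfolding w_def by measurable
  define A where "A = (\<integral>\<^sup>+p. ennreal (norm p ^ (2 * a)) * indicator ?B p \<partial>lborel)"
  have w_int: "(\<integral>\<^sup>+t. ennreal (w t) * indicator {s..1} t \<partial>lborel) = ennreal (1 - s ^ (2 * a))"
    if "0 \<le> s" "s \<le> 1" for s
  proof -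
    have "(\<integral>\<^sup>+t. ennreal (w t) * indicator {s..1} t \<partial>lborel) = ennreal (1 ^ (2 * a) - s ^ (2 * a))"
      using that by (intro nn_integral_FTC_Icc) (auto intro!: derivative_eq_intros simp: w_def)
    then show ?thesis by simp
  qed
  have inner: "(\<integral>\<^sup>+t. ennreal (w t) * indicator {0..1} t * indicator (ball 0 t) p \<partial>lborel)
      = ennreal (1 - norm p ^ (2 * a)) * indicator ?B p" for p :: "real \<times> real"
  proof (cases "p \<in> ?B")
    case True
    have "(\<integral>\<^sup>+t. ennreal (w t) * indicator {0..1} t * indicator (ball 0 t) p \<partial>lborel)
       = (\<integral>\<^sup>+t. ennreal (w t) * indicator {norm p..1} t \<partial>lborel)"
    proof (rule nn_integral_cong_AE)
      \<comment> \<open>The two integrands differ at most at \<open>t = norm p\<close>, which the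
        closed interval contains and the open ball condition excludes.\<close>
      show "AE t in lborel. ennreal (w t) * indicator {0..1} t * indicator (ball 0 t) p = ennreal (w t) * indicator {norm p..1} t"
        using AE_lborel_singleton[of "norm p"]
        by eventually_elim (auto simp: indicator_def order_trans[OF norm_ge_zero])
    qed
    then show ?thesis using True w_int[of "norm p"] by simp
  next
    case False
    then have "(\<lambda>t. ennreal (w t) * indicator {0..1} t * indicator (ball 0 t) p) = (\<lambda>_. 0)"
      by (auto simp: indicator_def fun_eq_iff)
    then show ?thesis using False by simp
  qed
  have "ennreal pi = (\<integral>\<^sup>+p. indicator ?B p \<partial>lborel)"
    by (simp add: emeasure_disk)
  also have "\<dots> = (\<integral>\<^sup>+p. ennreal (norm p ^ (2 * a)) * indicator ?B p + ennreal (1 - norm p ^ (2 * a)) * indicator ?B p \<partial>lborel)"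
  proof (rule nn_integral_cong)
    fix p :: "real \<times> real"
    show "indicator ?B p = ennreal (norm p ^ (2 * a)) * indicator ?B p + ennreal (1 - norm p ^ (2 * a)) * indicator ?B p"
    proof (cases "p \<in> ?B")
      case True
      then have "norm p ^ (2 * a) \<le> 1" by (simp add: power_le_one)
      then show ?thesis using True
        by (subst distrib_right[symmetric], subst ennreal_plus[symmetric]) auto
    qed simp
  qed
  also have "\<dots> = A + (\<integral>\<^sup>+p. ennreal (1 - norm p ^ (2 * a)) * indicator ?B p \<partial>lborel)"
    unfolding A_def by (rule nn_integral_add) auto
  also have "(\<integral>\<^sup>+p. ennreal (1 - norm p ^ (2 * a)) * indicator ?B p \<partial>lborel)
      = (\<integral>\<^sup>+p. \<integral>\<^sup>+t. ennreal (w t) * indicator {0..1} t * indicator (ball (0::real\<times>real) t) p \<partial>lborel \<partial>lborel)"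
    by (intro nn_integral_cong inner[symmetric])
  also have "\<dots> = (\<integral>\<^sup>+t. \<integral>\<^sup>+p. ennreal (w t) * indicator {0..1} t * indicator (ball (0::real\<times>real) t) p \<partial>lborel \<partial>lborel)"
  proof (rule lborel_pair.Fubini'[symmetric])
    have "{q :: (real\<times>real) \<times> real. norm (fst q) < snd q} \<in> sets borel"
      by (intro borel_open open_Collect_less continuous_intros)
    then have [measurable]: "{q :: (real\<times>real) \<times> real. norm (fst q) < snd q} \<in> sets (borel \<Otimes>\<^sub>M borel)"
      by (simp only: borel_prod)
    have "(\<lambda>q. ennreal (w (snd q)) * indicator {0..1} (snd q) * indicator {q. norm (fst q) < snd q} q)
       \<in> borel_measurable (borel \<Otimes>\<^sub>M borel)"
      by measurable
    then show "(\<lambda>(p::real\<times>real, t). ennreal (w t) * indicator {0..1} t * indicator (ball 0 t) p) \<in> borel_measurable (lborel \<Otimes>\<^sub>M lborel)"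
      by (simp add: indicator_def case_prod_unfold)
  qed
  also have "\<dots> = (\<integral>\<^sup>+t. ennreal (pi * 2 * real a * t ^ (2 * a + 1)) * indicator {0..1} t \<partial>lborel)"
  proof (rule nn_integral_cong)
    fix t :: real
    show "(\<integral>\<^sup>+p. ennreal (w t) * indicator {0..1} t * indicator (ball (0::real\<times>real) t) p \<partial>lborel)
       = ennreal (pi * 2 * real a * t ^ (2 * a + 1)) * indicator {0..1} t"
    proof (cases "t \<in> {0..1}")
      case True
      have "t ^ (2 * a - 1) * t\<^sup>2 = t ^ (2 * a + 1)"
        using False by (simp flip: power_add)
      then have eq: "w t * (pi * t\<^sup>2) = pi * 2 * real a * t ^ (2 * a + 1)"
        by (simp add: w_def mult_ac)
      have "(\<integral>\<^sup>+p. ennreal (w t) * indicator {0..1} t * indicator (ball (0::real\<times>real) t) p \<partial>lborel)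
          = ennreal (w t) * ennreal (pi * t\<^sup>2)"
        using True by (simp add: nn_integral_cmult_indicator emeasure_disk)
      also have "\<dots> = ennreal (w t * (pi * t\<^sup>2))"
        using True by (subst ennreal_mult) (auto simp: w_def)
      finally show ?thesis unfolding eq using True by simp
    qed simp
  qed
  also have "\<dots> = ennreal (pi * real a / (real a + 1) * 1 ^ (2 * a + 2) - pi * real a / (real a + 1) * 0 ^ (2 * a + 2))"
  proof (rule nn_integral_FTC_Icc[where F = "\<lambda>t. pi * real a / (real a + 1) * t ^ (2 * a + 2)"])
    fix t :: real
    define c where "c = pi * real a / (real a + 1)"
    have "real a + 1 \<noteq> 0" by linarith
    then have c1: "c * (real a + 1) = pi * real a" by (simp add: c_def)
    have "real (2 * a + 2) = 2 * (real a + 1)" "2 * a + 2 - 1 = 2 * a + 1" by simp_all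
    then have "c * (real (2 * a + 2) * t ^ (2 * a + 2 - 1)) = 2 * (c * (real a + 1)) * t ^ (2 * a + 1)"
      by (simp only: mult_ac)
    then have c: "c * (real (2 * a + 2) * t ^ (2 * a + 2 - 1)) = pi * 2 * real a * t ^ (2 * a + 1)"
      unfolding c1 by (simp only: mult_ac)
    have "((\<lambda>t. pi * real a / (real a + 1) * t ^ (2 * a + 2)) has_real_derivative
        pi * real a / (real a + 1) * (real (2 * a + 2) * t ^ (2 * a + 2 - 1))) (at t)"
      using DERIV_pow[of "2 * a + 2" t UNIV] by (intro DERIV_cmult) simp
    then show "((\<lambda>t. pi * real a / (real a + 1) * t ^ (2 * a + 2)) has_real_derivative pi * 2 * real a * t ^ (2 * a + 1)) (at t)"
      unfolding c[unfolded c_def] .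
  qed auto
  also have "\<dots> = ennreal (pi * real a / (real a + 1))" by simp
  finally have *: "ennreal pi = A + ennreal (pi * real a / (real a + 1))" .
  \<comment> \<open>Finiteness of \<open>A\<close> comes first, since cancellation in
    \<open>ennreal\<close> fails at infinity.\<close>
  then have "A \<noteq> top" by auto
  then obtain x where x: "A = ennreal x" "0 \<le> x" by (cases A) auto
  have "pi = x + pi * real a / (real a + 1)"
  proof -
    have "ennreal pi = ennreal (x + pi * real a / (real a + 1))"
      using * x by (subst ennreal_plus) auto
    then show ?thesis using x by (subst (asm) ennreal_inj) auto
  qed
  then have "x = pi / (real a + 1)" by (simp add: divide_simps) (simp add: algebra_simps)
  then show ?thesis using x by (simp add: A_def)
qed

lemma integral_disk_norm_power:
  "(\<integral>p. indicator (ball (0::real\<times>real) 1) p *\<^sub>R (norm p ^ (2 * a)) \<partial>lborel) = pi / (real a + 1)"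
proof -
  have "(\<integral>p. indicator (ball (0::real\<times>real) 1) p *\<^sub>R (norm p ^ (2 * a)) \<partial>lborel)
     = enn2real (\<integral>\<^sup>+p. ennreal (indicator (ball (0::real\<times>real) 1) p *\<^sub>R (norm p ^ (2 * a))) \<partial>lborel)"
    by (intro integral_eq_nn_integral)
      (auto intro!: borel_measurable_times borel_measurable_indicator borel_measurable_continuous_onI[of "\<lambda>p. norm p ^ (2 * a)"] continuous_intros)
  also have "(\<integral>\<^sup>+p. ennreal (indicator (ball (0::real\<times>real) 1) p *\<^sub>R (norm p ^ (2 * a))) \<partial>lborel)
     = (\<integral>\<^sup>+p. ennreal (norm p ^ (2 * a)) * indicator (ball (0::real\<times>real) 1) p \<partial>lborel)"
    by (intro nn_integral_cong) (auto simp: indicator_def)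
  finally show ?thesis by (simp add: nn_integral_disk_norm_power)
qed

section \<open>From the disk to the half disk\<close>

lemma integral_half_disk_lborel:
  fixes f :: "real \<times> real \<Rightarrow> real"
  assumes "continuous_on UNIV f"
  shows "(\<integral>p. f p \<partial>lebesgue_on half_disk) = (\<integral>p. indicator half_disk p *\<^sub>R f p \<partial>lborel)"
proof -
  have [measurable]: "f \<in> borel_measurable borel" "half_disk \<in> sets borel"
    using assms open_half_disk by (auto intro: borel_measurable_continuous_onI)
  have "(\<integral>p. f p \<partial>lebesgue_on half_disk) = (\<integral>p. indicator half_disk p *\<^sub>R f p \<partial>lebesgue)"
    by (rule integral_restrict_space) auto
  also have "\<dots> = (\<integral>p. indicator half_disk p *\<^sub>R f p \<partial>lborel)"
    by (rule integral_completion) measurable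
  finally show ?thesis .
qed

lemma integral_half_disk_even:
  fixes f :: "real \<times> real \<Rightarrow> real"
  assumes f: "continuous_on UNIV f" and even: "\<And>x y. f (x, - y) = f (x, y)"
  shows "(\<integral>p. f p \<partial>lebesgue_on half_disk) = (\<integral>p. indicator (ball 0 1) p *\<^sub>R f p \<partial>lborel) / 2"
proof -
  let ?r = "\<lambda>p::real\<times>real. (fst p, 0 + - 1 * snd p)"
  let ?L = "ball 0 1 \<inter> {p :: real \<times> real. snd p < 0}"
  have r: "distr lborel borel ?r = lborel"
    by (rule distr_lborel_snd_affine) auto
  have [measurable]: "f \<in> borel_measurable borel"
    using f by (auto intro: borel_measurable_continuous_onI)
  have [measurable]: "ball (0::real\<times>real) 1 \<in> sets borel" by simp
  have hd [measurable]: "half_disk \<in> sets borel" using open_half_disk by auto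
  have ol: "open ?L"
    by (intro open_Int open_ball open_Collect_less continuous_intros)
  then have L [measurable]: "?L \<in> sets borel" by auto
  have [measurable]: "?r \<in> borel_measurable borel"
    by (simp add: borel_prod[symmetric])
  have "(\<integral>p. indicator half_disk p *\<^sub>R f p \<partial>lborel) = (\<integral>p. indicator half_disk p *\<^sub>R f p \<partial>distr lborel borel ?r)"
    by (simp only: r)
  also have "\<dots> = (\<integral>p. indicator half_disk (?r p) *\<^sub>R f (?r p) \<partial>lborel)"
    by (rule integral_distr) measurable
  also have "\<dots> = (\<integral>p. indicator ?L p *\<^sub>R f p \<partial>lborel)"
    by (intro Bochner_Integration.integral_cong)
       (auto simp: even half_disk_eq indicator_def norm_prod_def)
  finally have eq: "(\<integral>p. indicator half_disk p *\<^sub>R f p \<partial>lborel) = (\<integral>p. indicator ?L p *\<^sub>R f p \<partial>lborel)" .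
  \<comment> \<open>Neither open half contains the diameter, so the disk is their union only up to
    this null set.\<close>
  have "{p :: real \<times> real. snd p = 0} = {p. (0, 1) \<bullet> p = 0}" by auto
  then have "negligible {p :: real \<times> real. snd p = 0}"
    using negligible_hyperplane[of "(0, 1) :: real \<times> real" 0] by (simp add: zero_prod_def)
  then have "{p :: real \<times> real. snd p = 0} \<in> null_sets lebesgue"
    by (simp add: negligible_iff_null_sets)
  moreover have "{p :: real \<times> real. snd p = 0} \<in> sets borel"
    by (intro borel_closed closed_Collect_eq continuous_intros)
  ultimately have "{p :: real \<times> real. snd p = 0} \<in> null_sets lborel"
    by (simp add: null_sets_def)
  then have AE0: "AE p in lborel. snd (p :: real \<times> real) \<noteq> 0"
    by (rule AE_I') auto
  have "(\<integral>p. indicator (ball 0 1) p *\<^sub>R f p \<partial>lborel)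
      = (\<integral>p. indicator half_disk p *\<^sub>R f p + indicator ?L p *\<^sub>R f p \<partial>lborel)"
  proof (rule integral_cong_AE)
    show "AE p in lborel. indicator (ball 0 1) p *\<^sub>R f p = indicator half_disk p *\<^sub>R f p + indicator ?L p *\<^sub>R f p"
      using AE0 by eventually_elim (auto simp: half_disk_eq indicator_def)
  qed auto
  also have "\<dots> = (\<integral>p. indicator half_disk p *\<^sub>R f p \<partial>lborel) + (\<integral>p. indicator ?L p *\<^sub>R f p \<partial>lborel)"
    by (intro Bochner_Integration.integral_add integrable_indicator_continuous hd L f)
       (auto simp: half_disk_eq intro: bounded_subset[OF bounded_ball])
  finally show ?thesis
    using eq by (simp add: integral_half_disk_lborel[OF f])
qed

text \<open>Conjugation makes the real part even in y, so its integral is half of that over the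
  disk. The imaginary part is odd and has no such relation: the orthogonality passes to the half
  disk for cosines only.\<close>

lemma integral_half_disk_zmono:
  "(\<integral>p. Re (zmono a b p) \<partial>lebesgue_on half_disk) = (if a = b then pi / (2 * (real a + 1)) else 0)"
proof -
  have *: "zmono a b (x, - y) = cnj (zmono a b (x, y))" for x y
  proof -
    have "cpx (x, - y) = cnj (cpx (x, y))" by (simp add: cpx_def complex_eq_iff)
    then show ?thesis by (simp add: zmono_def)
  qed
  have "(\<integral>p. Re (zmono a b p) \<partial>lebesgue_on half_disk) = (\<integral>p. indicator (ball 0 1) p *\<^sub>R Re (zmono a b p) \<partial>lborel) / 2"
    by (rule integral_half_disk_even) (auto simp: * intro!: continuous_intros)
  moreover have "(\<integral>p. indicator (ball 0 1) p *\<^sub>R Re (zmono a b p) \<partial>lborel) = (if a = b then pi / (real a + 1) else 0)"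
  proof (cases "a = b")
    case True
    have "Re (zmono a a p) = norm p ^ (2 * a)" for p
    proof -
      have "zmono a a p = complex_of_real ((norm p)\<^sup>2) ^ a"
        by (simp only: zmono_def power_mult_distrib[symmetric] complex_norm_square[symmetric] norm_cpx)
      then show ?thesis by (simp add: power_mult flip: of_real_power)
    qed
    then show ?thesis using True integral_disk_norm_power[of a] by simp
  next
    case False
    have "(\<integral>p. indicator (ball 0 1) p *\<^sub>R Re (zmono a b p) \<partial>lborel) = (\<integral>p. Re (indicator (ball 0 1) p *\<^sub>R zmono a b p) \<partial>lborel)"
      by simp
    also have "\<dots> = Re (\<integral>p. indicator (ball 0 1) p *\<^sub>R zmono a b p \<partial>lborel)"
      by (intro integral_Re integrable_indicator_continuous continuous_intros) auto
    finally show ?thesis using False integral_disk_zmono_eq_0[OF False] by simp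
  qed
  ultimately show ?thesis by (simp only:) (simp add: field_simps)
qed

section \<open>The Dirichlet problem with data \<open>sin (n \<phi>)\<close>\<close>

lemma grad_eqI: "GDERIV u x :> D \<Longrightarrow> grad u x = D"
  unfolding grad_def
proof (rule the_equality)
  fix D' assume "GDERIV u x :> D" "GDERIV u x :> D'"
  then have "(\<lambda>h. h \<bullet> D') = (\<lambda>h. h \<bullet> D)"
    unfolding gderiv_def by (metis has_derivative_unique)
  then show "D' = D" by (metis vector_eq_ldot)
qed

text \<open>Makes the definite description in \<open>grad\<close> usable for an unknown solution, of
  which only differentiability is given: the derivative is represented by a vector through its
  values on the basis.\<close>

lemma GDERIV_grad:
  assumes "u differentiable (at x)"
  shows "GDERIV u x :> grad u x"
proof -
  obtain f' where f': "(u has_derivative f') (at x)"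
    using assms by (auto simp: differentiable_def)
  interpret f': bounded_linear f' using f' by (rule has_derivative_bounded_linear)
  have "f' h = h \<bullet> (\<Sum>b\<in>Basis. f' b *\<^sub>R b)" for h
  proof -
    have "f' h = f' (\<Sum>b\<in>Basis. (h \<bullet> b) *\<^sub>R b)" by (simp add: euclidean_representation)
    also have "\<dots> = (\<Sum>b\<in>Basis. (h \<bullet> b) * f' b)" by (simp add: f'.sum f'.scaleR)
    finally show ?thesis by (simp add: inner_sum_right mult.commute)
  qed
  then have "f' = (\<lambda>h. h \<bullet> (\<Sum>b\<in>Basis. f' b *\<^sub>R b))" by blast
  with f' have D: "GDERIV u x :> (\<Sum>b\<in>Basis. f' b *\<^sub>R b)"
    unfolding gderiv_def by metis
  show ?thesis unfolding grad_eqI[OF D] by (rule D)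
qed

lemma grad_transform_open:
  assumes "open S" "x \<in> S" "\<And>y. y \<in> S \<Longrightarrow> u y = v y" "GDERIV u x :> D"
  shows "grad v x = D"
proof (rule grad_eqI)
  show "GDERIV v x :> D"
    using assms has_derivative_transform_within_open[of u "\<lambda>h. h \<bullet> D" x UNIV S v]
    by (simp add: gderiv_def)
qed

section \<open>Maximum principle and uniqueness for the Dirichlet problem\<close>

text \<open>If \<open>D\<close> were positive, \<psi> would vanish at the maximum and be positive
  just to its right, and by the mean value theorem \<phi> would rise above its maximum. No
  second-order Taylor expansion enters, so \<psi> need be differentiable only at 0.\<close>

lemma second_derivative_nonpos_at_max:
  fixes \<phi> \<psi> :: "real \<Rightarrow> real"
  assumes "0 < \<delta>" and \<phi>: "\<And>t. \<bar>t\<bar> < \<delta> \<Longrightarrow> (\<phi> has_real_derivative \<psi> t) (at t)"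
    and \<psi>: "(\<psi> has_real_derivative D) (at 0)"
    and max: "\<And>t. \<bar>t\<bar> < \<delta> \<Longrightarrow> \<phi> t \<le> \<phi> 0"
  shows "D \<le> 0"
proof (rule ccontr)
  assume "\<not> D \<le> 0"
  then obtain d where d: "0 < d" "\<And>h. 0 < h \<Longrightarrow> h < d \<Longrightarrow> \<psi> 0 < \<psi> h"
    using DERIV_pos_inc_right[OF \<psi>] by auto
  have "\<psi> 0 = 0"
    by (rule DERIV_local_max[OF \<phi>[of 0] \<open>0 < \<delta>\<close>]) (use assms in auto)
  define s where "s = min d \<delta> / 2"
  have s: "0 < s" "s < d" "s < \<delta>" using d \<open>0 < \<delta>\<close> by (auto simp: s_def min_def)
  obtain z where z: "0 < z" "z < s" "\<phi> s - \<phi> 0 = (s - 0) * \<psi> z"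
    using MVT2[OF s(1), of \<phi> \<psi>] \<phi> s by force
  have "0 < \<psi> z" using d(2)[of z] z s \<open>\<psi> 0 = 0\<close> by simp
  then have "\<phi> 0 < \<phi> s" using z s by (metis diff_gt_0_iff_gt diff_zero mult_pos_pos)
  then show False using max[of s] s by simp
qed

text \<open>Every summand is the second derivative of \<open>w\<close> along a coordinate line
  through the maximum point.\<close>

lemma laplacian_nonpos_at_max:
  fixes w :: "'a::euclidean_space \<Rightarrow> real"
  assumes S: "open S" "q \<in> S" and g: "\<And>x. x \<in> S \<Longrightarrow> GDERIV w x :> g x"
    and h: "(g has_derivative h) (at q)" and max: "\<And>x. x \<in> S \<Longrightarrow> w x \<le> w q"
  shows "(\<Sum>b\<in>Basis. h b \<bullet> b) \<le> 0"
proof (rule sum_nonpos)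
  fix b :: 'a assume b: "b \<in> Basis"
  obtain \<delta> where \<delta>: "0 < \<delta>" "ball q \<delta> \<subseteq> S" using S open_contains_ball by blast
  have inS: "q + t *\<^sub>R b \<in> S" if "\<bar>t\<bar> < \<delta>" for t
    using that \<delta>(2) b by (auto simp: dist_norm)
  show "h b \<bullet> b \<le> 0"
  proof (rule second_derivative_nonpos_at_max[of \<delta> "\<lambda>t. w (q + t *\<^sub>R b)" "\<lambda>t. g (q + t *\<^sub>R b) \<bullet> b"])
    show "((\<lambda>t. w (q + t *\<^sub>R b)) has_real_derivative g (q + t *\<^sub>R b) \<bullet> b) (at t)" if "\<bar>t\<bar> < \<delta>" for t
    proof -
      have "((\<lambda>t. q + t *\<^sub>R b) has_derivative (\<lambda>t. t *\<^sub>R b)) (at t)"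
        by (auto intro!: derivative_eq_intros)
      moreover have "(w has_derivative (\<lambda>h. h \<bullet> g (q + t *\<^sub>R b))) (at (q + t *\<^sub>R b))"
        using g[OF inS[OF that]] by (simp add: gderiv_def)
      ultimately have "((\<lambda>t. w (q + t *\<^sub>R b)) has_derivative (\<lambda>s. (s *\<^sub>R b) \<bullet> g (q + t *\<^sub>R b))) (at t)"
        by (rule has_derivative_compose)
      moreover have "(\<lambda>s. (s *\<^sub>R b) \<bullet> g (q + t *\<^sub>R b)) = (*) (g (q + t *\<^sub>R b) \<bullet> b)"
        by (simp add: fun_eq_iff inner_commute)
      ultimately show ?thesis
        by (simp only: has_field_derivative_def)
    qed
    have "((\<lambda>t. q + t *\<^sub>R b) has_derivative (\<lambda>t. t *\<^sub>R b)) (at 0)"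
      by (auto intro!: derivative_eq_intros)
    then have "((\<lambda>t. g (q + t *\<^sub>R b)) has_derivative (\<lambda>s. h (s *\<^sub>R b))) (at 0)"
      by (rule has_derivative_compose) (simp add: h)
    then have "((\<lambda>t. g (q + t *\<^sub>R b) \<bullet> b) has_derivative (\<lambda>s. h (s *\<^sub>R b) \<bullet> b)) (at 0)"
      by (rule has_derivative_inner_left)
    moreover have "(\<lambda>s. h (s *\<^sub>R b) \<bullet> b) = (*) (h b \<bullet> b)"
      using has_derivative_linear[OF h] by (simp add: linear_scale fun_eq_iff)
    ultimately show "((\<lambda>t. g (q + t *\<^sub>R b) \<bullet> b) has_real_derivative h b \<bullet> b) (at 0)"
      by (simp only: has_field_derivative_def)
  qed (use \<delta> inS max in auto)
qed

lemma closure_half_disk: "closure half_disk \<subseteq> cball 0 1 \<inter> {p. 0 \<le> snd p}"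
  by (rule closure_minimal)
     (auto simp: half_disk_eq intro!: closed_Int closed_Collect_le continuous_intros)

lemma frontier_half_disk_cases:
  assumes "p \<in> closure half_disk" "p \<notin> half_disk"
  shows "p \<in> Gamma_arc \<or> p \<in> Gamma_0"
proof -
  have "p \<in> frontier half_disk"
    using assms open_half_disk by (simp add: frontier_def interior_open)
  moreover have "0 \<le> snd p" using assms closure_half_disk by auto
  ultimately show ?thesis by (auto simp: Gamma_arc_def Gamma_0_def)
qed

lemma norm_Gamma_arc:
  assumes "p \<in> Gamma_arc"
  shows "norm p = 1"
proof -
  have "p \<in> closure half_disk" "p \<notin> half_disk" "0 < snd p"
    using assms open_half_disk by (auto simp: Gamma_arc_def frontier_def interior_open)
  then show ?thesis using closure_half_disk by (auto simp: half_disk_eq)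
qed

text \<open>Used in both directions it gives uniqueness, the only access to a solution picked by
  Hilbert choice.\<close>

lemma solves_dirichlet_le:
  assumes v1: "solves_dirichlet f v1" and v2: "solves_dirichlet f v2"
    and p0: "p0 \<in> closure half_disk"
  shows "v1 p0 \<le> v2 p0"
proof (rule field_le_epsilon)
  \<comment> \<open>The perturbation \<open>\<epsilon> * (p \<bullet> p)\<close> makes the Laplacian of the difference strictly positive.\<close>
  fix \<epsilon> :: real assume \<epsilon>: "0 < \<epsilon>"
  let ?C = "closure half_disk"
  define w where "w p = v1 p - v2 p + \<epsilon> * (p \<bullet> p)" for p
  have cont: "continuous_on ?C w"
    unfolding w_def using v1 v2 by (intro continuous_intros) (auto simp: solves_dirichlet_def)
  have "compact ?C"
    by (simp add: compact_closure half_disk_eq bounded_Int)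
  then obtain q where q: "q \<in> ?C" "\<And>p. p \<in> ?C \<Longrightarrow> w p \<le> w q"
    using continuous_attains_sup[OF _ _ cont] p0 by (metis empty_iff)
  have bdry: "w p \<le> \<epsilon>" if "p \<in> ?C" "p \<notin> half_disk" for p
  proof -
    have "v1 p = v2 p"
      using frontier_half_disk_cases[OF that] v1 v2 by (auto simp: solves_dirichlet_def)
    moreover have "p \<bullet> p \<le> 1"
      using closure_half_disk that(1) by (auto simp: dot_square_norm power_le_one)
    ultimately show ?thesis using \<epsilon> by (simp add: w_def mult_left_le)
  qed
  have "w p0 \<le> \<epsilon>"
  proof (cases "q \<in> half_disk")
    case False
    then show ?thesis using bdry[OF q(1)] q(2)[OF p0] by simp
  next
    \<comment> \<open>An interior maximum is impossible: the Laplacian of \<open>w\<close> there is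
      0 - 0 + 4\<epsilon>, yet at a maximum it is at most 0. Hence the maximum is on the boundary,
      where \<open>w \<le> \<epsilon>\<close>.\<close>
    case True
    have sub: "half_disk \<subseteq> ?C" by (rule closure_subset)
    have dv: "v1 differentiable (at x)" "v2 differentiable (at x)"
      "grad v1 differentiable (at x)" "grad v2 differentiable (at x)" if "x \<in> half_disk" for x
      using v1 v2 that by (auto simp: solves_dirichlet_def harmonic_on_def C2_on_def)
    define g where "g x = grad v1 x - grad v2 x + (2 * \<epsilon>) *\<^sub>R x" for x
    define h where "h y = hessian v1 q y - hessian v2 q y + (2 * \<epsilon>) *\<^sub>R y" for y
    have "(\<Sum>b\<in>Basis. h b \<bullet> b) \<le> 0"
    proof (rule laplacian_nonpos_at_max[OF open_half_disk True])
      show "GDERIV w x :> g x" if "x \<in> half_disk" for x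
      proof -
        have "(v1 has_derivative (\<lambda>h. h \<bullet> grad v1 x)) (at x)" "(v2 has_derivative (\<lambda>h. h \<bullet> grad v2 x)) (at x)"
          using GDERIV_grad dv[OF that] by (auto simp: gderiv_def)
        then show ?thesis unfolding gderiv_def w_def g_def
          by (auto intro!: derivative_eq_intros simp: fun_eq_iff inner_diff_right inner_add_right inner_commute algebra_simps)
      qed
      have "(grad v1 has_derivative hessian v1 q) (at q)" "(grad v2 has_derivative hessian v2 q) (at q)"
        using dv[OF True] by (auto simp: hessian_def frechet_derivative_works[symmetric])
      then show "(g has_derivative h) (at q)"
        unfolding g_def h_def by (auto intro!: derivative_eq_intros)
      show "w x \<le> w q" if "x \<in> half_disk" for x using q(2) sub that by blast
    qed
    moreover have "(\<Sum>b\<in>Basis. h b \<bullet> b) = laplacian v1 q - laplacian v2 q + 2 * \<epsilon> * DIM(real \<times> real)"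
      by (simp add: h_def laplacian_def inner_add_left inner_diff_left sum.distrib sum_subtractf inner_Basis)
    moreover have "laplacian v1 q = 0" "laplacian v2 q = 0"
      using v1 v2 True by (auto simp: solves_dirichlet_def harmonic_on_def)
    ultimately show ?thesis using \<epsilon> by simp
  qed
  moreover have "0 \<le> \<epsilon> * (p0 \<bullet> p0)" using \<epsilon> by simp
  ultimately show "v1 p0 \<le> v2 p0 + \<epsilon>" by (simp add: w_def)
qed

section \<open>The explicit solutions and the data they produce\<close>

definition im_power :: "nat \<Rightarrow> real \<times> real \<Rightarrow> real" where
  "im_power n p = Im (cpx p ^ n)"

lemma has_derivative_cpx_power:
  "((\<lambda>p. cpx p ^ n) has_derivative (\<lambda>h. of_nat n * cpx p ^ (n - 1) * cpx h)) (at p)"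
  using has_derivative_power[OF bounded_linear.has_derivative[OF bounded_linear_cpx has_derivative_ident], where n = n]
  by (simp add: mult_ac)

lemma GDERIV_im_power:
  "GDERIV (im_power n) p :> (Im (of_nat n * cpx p ^ (n - 1)), Re (of_nat n * cpx p ^ (n - 1)))"
proof -
  have "((\<lambda>p. Im (cpx p ^ n)) has_derivative (\<lambda>h. Im (of_nat n * cpx p ^ (n - 1) * cpx h))) (at p)"
    by (rule bounded_linear.has_derivative[OF bounded_linear_Im has_derivative_cpx_power])
  \<comment> \<open>For a holomorphic F with derivative w, the differential of Im F is h -> Im (w
    h), which the inner product represents by (Im w, Re w).\<close>
  moreover have "Im (w * cpx h) = h \<bullet> (Im w, Re w)" for w h
    by (simp add: cpx_def inner_prod_def mult.commute add.commute)
  ultimately show ?thesis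
    by (simp only: gderiv_def im_power_def[abs_def])
qed

lemma grad_im_power: "grad (im_power n) p = (Im (of_nat n * cpx p ^ (n - 1)), Re (of_nat n * cpx p ^ (n - 1)))"
  by (rule grad_eqI[OF GDERIV_im_power])

text \<open>For \<open>n \<le> 1\<close> the truncated exponent \<open>n - 2\<close> is harmless,
  because one of the factors \<open>of_nat n\<close> and \<open>of_nat (n - 1)\<close>
  vanishes.\<close>

lemma has_derivative_grad_im_power:
  "(grad (im_power n) has_derivative (\<lambda>h. (Im (of_nat n * (of_nat (n - 1) * cpx p ^ (n - 2) * cpx h)),
     Re (of_nat n * (of_nat (n - 1) * cpx p ^ (n - 2) * cpx h))))) (at p)"
proof -
  have d: "((\<lambda>p. of_nat n * cpx p ^ (n - 1)) has_derivative (\<lambda>h. of_nat n * (of_nat (n - 1) * cpx p ^ (n - 1 - 1) * cpx h))) (at p)"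
    by (intro has_derivative_mult_right has_derivative_cpx_power)
  have "grad (im_power n) = (\<lambda>p. (Im (of_nat n * cpx p ^ (n - 1)), Re (of_nat n * cpx p ^ (n - 1))))"
    by (simp add: fun_eq_iff grad_im_power)
  moreover have "n - 1 - 1 = n - 2" by simp
  ultimately show ?thesis
    using has_derivative_Pair[OF bounded_linear.has_derivative[OF bounded_linear_Im d] bounded_linear.has_derivative[OF bounded_linear_Re d]]
    by (simp only:)
qed

lemma hessian_im_power:
  "hessian (im_power n) p = (\<lambda>h. (Im (of_nat n * (of_nat (n - 1) * cpx p ^ (n - 2) * cpx h)),
     Re (of_nat n * (of_nat (n - 1) * cpx p ^ (n - 2) * cpx h))))"
  unfolding hessian_def by (rule frechet_derivative_at[OF has_derivative_grad_im_power, symmetric])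

lemma sum_Basis_real_prod:
  fixes f :: "real \<times> real \<Rightarrow> real"
  shows "(\<Sum>b\<in>Basis. f b) = f (1, 0) + f (0, 1)"
proof -
  have "(Basis :: (real \<times> real) set) = {(1, 0), (0, 1)}"
    by (auto simp: Basis_prod_def)
  from arg_cong[OF this, of "sum f"] show ?thesis by simp
qed

lemma solves_dirichlet_im_power:
  assumes "1 \<le> n"
  shows "solves_dirichlet (sin_data n) (im_power n)"
  unfolding solves_dirichlet_def
proof (intro conjI ballI)
  show "continuous_on (closure half_disk) (im_power n)"
    unfolding im_power_def by (intro continuous_intros)
  show "harmonic_on half_disk (im_power n)"
    unfolding harmonic_on_def C2_on_def
  proof (intro conjI ballI)
    fix x
    show "im_power n differentiable at x"
      using GDERIV_im_power[of n x] unfolding gderiv_def differentiable_def by blast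
    show "grad (im_power n) differentiable at x"
      using has_derivative_grad_im_power[of n x] unfolding differentiable_def by blast
    show "continuous_on half_disk (\<lambda>x. hessian (im_power n) x b)" for b
      unfolding hessian_im_power by (intro continuous_intros)
    show "laplacian (im_power n) x = 0"
    proof -
      \<comment> \<open>The trace of the Hessian is Im c + Re (c i) = Im c - Im c, so it
        vanishes.\<close>
      define c where "c = of_nat n * (of_nat (n - 1) * cpx x ^ (n - 2))"
      have "hessian (im_power n) x h = (Im (c * cpx h), Re (c * cpx h))" for h
        by (simp add: hessian_im_power c_def mult.assoc)
      then show ?thesis
        by (simp add: laplacian_def sum_Basis_real_prod inner_prod_def cpx_def)
    qed
  qed
next
  fix p assume p: "p \<in> Gamma_arc"
  then have "norm (cpx p) = 1" by (simp add: norm_Gamma_arc)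
  then have "cpx p = cis (Arg (cpx p))"
    by (metis cis_Arg div_by_1 norm_zero of_real_1 sgn_eq zero_neq_one)
  then have "cpx p ^ n = cis (real n * Arg (cpx p))"
    by (metis Complex.DeMoivre)
  then show "im_power n p = sin_data n (polar_angle p)"
    by (simp add: im_power_def sin_data_def polar_angle_def cpx_def)
next
  fix p assume "p \<in> Gamma_0"
  then have "cpx p = of_real (fst p)" by (simp add: Gamma_0_def cpx_def complex_eq_iff)
  then show "im_power n p = 0" by (simp add: im_power_def flip: of_real_power)
qed

text \<open>Uniqueness fixes the chosen solution on the closed half disk only, which is enough for
  the gradient at points of the open half disk.\<close>

lemma grad_dirichlet_sol:
  assumes "1 \<le> n" "p \<in> half_disk"
  shows "grad (dirichlet_sol (sin_data n)) p = (Im (of_nat n * cpx p ^ (n - 1)), Re (of_nat n * cpx p ^ (n - 1)))"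
proof (rule grad_transform_open[OF open_half_disk assms(2) _ GDERIV_im_power])
  have s: "solves_dirichlet (sin_data n) (im_power n)"
    by (rule solves_dirichlet_im_power[OF assms(1)])
  then have d: "solves_dirichlet (sin_data n) (dirichlet_sol (sin_data n))"
    unfolding dirichlet_sol_def by (rule someI[of "solves_dirichlet (sin_data n)"])
  fix y assume "y \<in> half_disk"
  then have "y \<in> closure half_disk" using closure_subset by blast
  then show "im_power n y = dirichlet_sol (sin_data n) y"
    using solves_dirichlet_le[OF s d] solves_dirichlet_le[OF d s] by (simp add: antisym)
qed

text \<open>Differentiation lowers the degree by one, hence the shifted indices of the data; the
  factors it produces are exactly those that \<open>p_coeff\<close> divides out.\<close>

lemma lin_DN_inc_sin_data:
  "lin_DN_inc \<gamma> (sin_data (l + 1)) (sin_data (m + 1)) =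
     real (l + 1) * real (m + 1) * (\<integral>p. \<gamma> p * Re (zmono m l p) \<partial>lebesgue_on half_disk)"
proof -
  have eq: "grad (dirichlet_sol (sin_data (l + 1))) p \<bullet> grad (dirichlet_sol (sin_data (m + 1))) p
      = real (l + 1) * real (m + 1) * Re (zmono m l p)" if "p \<in> half_disk" for p
  proof -
    have *: "(Im z, Re z) \<bullet> (Im w, Re w) = Re (w * cnj z)" for z w
      by (simp add: inner_prod_def)
    have "grad (dirichlet_sol (sin_data (l + 1))) p \<bullet> grad (dirichlet_sol (sin_data (m + 1))) p
       = Re ((of_nat (m + 1) * cpx p ^ m) * cnj (of_nat (l + 1) * cpx p ^ l))"
      using that by (simp only: grad_dirichlet_sol le_add2 * add_diff_cancel_right')
    also have "(of_nat (m + 1) * cpx p ^ m) * cnj (of_nat (l + 1) * cpx p ^ l)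
       = of_real (real (l + 1) * real (m + 1)) * zmono m l p"
      by (simp add: zmono_def mult_ac)
    also have "Re \<dots> = real (l + 1) * real (m + 1) * Re (zmono m l p)"
      by (simp only: times_complex.sel Re_complex_of_real Im_complex_of_real mult_zero_left diff_zero)
    finally show ?thesis .
  qed
  have "lin_DN_inc \<gamma> (sin_data (l + 1)) (sin_data (m + 1)) =
    (\<integral>p. (real (l + 1) * real (m + 1)) * (\<gamma> p * Re (zmono m l p)) \<partial>lebesgue_on half_disk)"
    unfolding lin_DN_inc_def
    by (intro Bochner_Integration.integral_cong refl) (simp only: eq space_lebesgue_on mult_ac)
  then show ?thesis by simp
qed

section \<open>Orthogonality of \<open>L_n^k(r) cos (k \<phi>)\<close>\<close>

lemma lagrange_interpolation:
  fixes p :: "'a::field poly"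
  assumes "finite A" "degree p < card A"
  shows "poly p x = (\<Sum>a\<in>A. poly p a * (\<Prod>b\<in>A - {a}. (x - b) / (a - b)))"
proof -
  define q where "q = (\<Sum>a\<in>A. smult (poly p a / (\<Prod>b\<in>A - {a}. a - b)) (\<Prod>b\<in>A - {a}. [:- b, 1:]))"
  have q: "poly q y = (\<Sum>a\<in>A. poly p a * (\<Prod>b\<in>A - {a}. (y - b) / (a - b)))" for y
    by (simp add: q_def poly_sum poly_prod prod_dividef)
  have "p = q"
  proof (rule poly_eqI_degree[of A])
    fix y assume y: "y \<in> A"
    have "poly q y = (\<Sum>a\<in>{y}. poly p a * (\<Prod>b\<in>A - {a}. (y - b) / (a - b)))"
      unfolding q
    proof (rule sum.mono_neutral_right[OF \<open>finite A\<close>])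
      show "\<forall>a\<in>A - {y}. poly p a * (\<Prod>b\<in>A - {a}. (y - b) / (a - b)) = 0"
      proof
        fix a assume "a \<in> A - {y}"
        then have "(\<Prod>b\<in>A - {a}. (y - b) / (a - b)) = 0"
          using y \<open>finite A\<close> by (intro prod_zero) auto
        then show "poly p a * (\<Prod>b\<in>A - {a}. (y - b) / (a - b)) = 0" by simp
      qed
    qed (use y in auto)
    also have "\<dots> = poly p y"
    proof -
      have "(\<Prod>b\<in>A - {y}. (y - b) / (y - b)) = 1"
        by (intro prod.neutral) auto
      then show ?thesis by simp
    qed
    finally show "poly p y = poly q y" by simp
  next
    show "card A > degree q"
    proof -
      have "degree q \<le> card A - 1"
        unfolding q_def
      proof (rule degree_sum_le[OF \<open>finite A\<close>])
        fix a assume a: "a \<in> A"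
        have "degree (\<Prod>b\<in>A - {a}. [:- b, 1:]) \<le> (\<Sum>b\<in>A - {a}. 1)"
          using degree_prod_sum_le[of "A - {a}" "\<lambda>b. [:- b, 1:]"] \<open>finite A\<close> by (simp add: o_def)
        also have "\<dots> = card A - 1" using a \<open>finite A\<close> by simp
        finally show "degree (smult (poly p a / (\<Prod>b\<in>A - {a}. a - b)) (\<Prod>b\<in>A - {a}. [:- b, 1:])) \<le> card A - 1"
          using degree_smult_le order_trans by blast
      qed
      then show ?thesis using assms by simp
    qed
  qed (use assms in simp)
  with q show ?thesis by metis
qed

text \<open>Put P(y) for the product of the factors y + j + k + 1 with j < n. Then
  \<open>L_coeff k l n\<close> is P(l) over the Lagrange denominator at the node l, and P has degree
  n, one less than the number of nodes. At -x the Lagrange numerators are, up to the sign (-1)^n,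
  the full product of the x + j divided by x + l, so the sum is P(-x) up to known factors. For x > 0
  no denominator x + l vanishes.\<close>

lemma sum_L_coeff_divide:
  fixes x :: real
  assumes "0 < x"
  shows "(\<Sum>l=0..n. L_coeff k l n / (x + real l)) =
    (- 1) ^ n * (\<Prod>j<n. real (j + k + 1) - x) / (\<Prod>j\<in>{0..n}. x + real j)"
proof -
  define P where "P = (\<Prod>j<n. [:real (j + k + 1), 1:])"
  have P: "poly P y = (\<Prod>j<n. y + real (j + k + 1))" for y
    by (simp add: P_def poly_prod add.commute)
  have "degree P \<le> (\<Sum>j<n. 1)"
    unfolding P_def using degree_prod_sum_le[of "{..<n}" "\<lambda>j. [:real (j + k + 1), 1:]"] by (simp add: o_def)
  then have deg: "degree P < card (real ` {0..n})"
    by (simp add: card_image)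
  let ?Q = "\<Prod>j\<in>{0..n}. x + real j"
  have Q: "?Q \<noteq> 0" using assms by (simp add: add_pos_nonneg less_imp_neq[symmetric])
  have img: "real ` {0..n} - {real l} = real ` ({0..n} - {l})" for l by auto
  have "poly P (- x) = (\<Sum>l=0..n. poly P (real l) * (\<Prod>j\<in>{0..n} - {l}. (- x - real j) / (real l - real j)))"
    using lagrange_interpolation[OF _ deg, of "- x"]
    by (simp add: sum.reindex img prod.reindex)
  also have "\<dots> = (\<Sum>l=0..n. (- 1) ^ n * ?Q * (L_coeff k l n / (x + real l)))"
  proof (rule sum.cong[OF refl])
    fix l assume l: "l \<in> {0..n}"
    have "(\<Prod>j\<in>{0..n} - {l}. - x - real j) = (\<Prod>j\<in>{0..n} - {l}. - 1 * (x + real j))"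
      by (intro prod.cong) auto
    also have "\<dots> = (- 1) ^ n * (\<Prod>j\<in>{0..n} - {l}. x + real j)"
      using l by (simp only: prod.distrib prod_constant) simp
    also have "(\<Prod>j\<in>{0..n} - {l}. x + real j) = ?Q / (x + real l)"
      using l assms by (subst prod.remove[of "{0..n}" l]) auto
    finally have "(\<Prod>j\<in>{0..n} - {l}. - x - real j) = (- 1) ^ n * ?Q / (x + real l)" by simp
    moreover have "L_coeff k l n = poly P (real l) / (\<Prod>j\<in>{0..n} - {l}. real l - real j)"
      by (simp add: L_coeff_def P add_ac)
    ultimately show "poly P (real l) * (\<Prod>j\<in>{0..n} - {l}. (- x - real j) / (real l - real j)) = (- 1) ^ n * ?Q * (L_coeff k l n / (x + real l))"
      by (simp add: prod_dividef mult_ac)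
  qed
  also have "\<dots> = (- 1) ^ n * ?Q * (\<Sum>l=0..n. L_coeff k l n / (x + real l))"
    by (simp add: sum_distrib_left)
  finally have "(- 1) ^ n * poly P (- x) = ((- 1) ^ n * (- 1) ^ n) * ?Q * (\<Sum>l=0..n. L_coeff k l n / (x + real l))"
    by (simp add: mult_ac)
  moreover have "(- 1) ^ n * (- 1) ^ n = (1::real)"
    by (simp flip: power_mult_distrib)
  moreover have "poly P (- x) = (\<Prod>j<n. real (j + k + 1) - x)"
    by (simp add: P)
  ultimately have "?Q * (\<Sum>l=0..n. L_coeff k l n / (x + real l)) = (- 1) ^ n * (\<Prod>j<n. real (j + k + 1) - x)"
    by simp
  then show ?thesis using Q by (simp add: field_simps)
qed

lemma prod_nodes_except:
  assumes "l \<le> n"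
  shows "(\<Prod>j\<in>{0..n} - {l}. real l - real j) = (- 1) ^ (n - l) * fact l * fact (n - l)"
proof -
  have split: "{0..n} - {l} = {..<l} \<union> {l<..n}" using assms by auto
  have "(\<Prod>j\<in>{0..n} - {l}. real l - real j) = (\<Prod>j<l. real l - real j) * (\<Prod>j\<in>{l<..n}. real l - real j)"
    unfolding split by (rule prod.union_disjoint) auto
  also have "(\<Prod>j<l. real l - real j) = (\<Prod>i\<in>{1..l}. real i)"
    by (rule prod.reindex_bij_witness[of _ "\<lambda>i. l - i" "\<lambda>j. l - j"]) auto
  also have "\<dots> = fact l" by (simp add: fact_prod)
  also have "(\<Prod>j\<in>{l<..n}. real l - real j) = (\<Prod>i\<in>{1..n - l}. - 1 * real i)"
    by (rule prod.reindex_bij_witness[of _ "\<lambda>i. l + i" "\<lambda>j. j - l"]) auto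
  also have "\<dots> = (- 1) ^ (n - l) * fact (n - l)"
    by (simp only: prod.distrib prod_constant card_atLeastAtMost) (simp add: fact_prod)
  finally show ?thesis by (simp add: mult_ac)
qed

text \<open>This is the form in which the coefficients occur inside \<open>p_coeff\<close>, and also
  the usual one of the Zernike coefficients; the sign moves to the numerator because it is its own
  inverse.\<close>

lemma L_coeff_eq:
  assumes "l \<le> n"
  shows "L_coeff k l n = (- 1) ^ (n - l) * (\<Prod>j<n. real (1 + k + l + j)) / (fact l * fact (n - l))"
proof -
  have "(- 1) ^ (n - l) * (- 1) ^ (n - l) = (1::real)"
    by (simp flip: power_mult_distrib)
  then have "inverse ((- 1) ^ (n - l)) = ((- 1) ^ (n - l) :: real)"
    by (metis inverse_unique)
  then show ?thesis
    using assms by (simp add: L_coeff_def prod_nodes_except divide_inverse add_ac mult_ac)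
qed

text \<open>The sum is twice the integral of L_n^k(r) r^(2m+k) against r dr over [0, 1]. The point
  -(m+k+1) is a root of the interpolated polynomial precisely when m < n.\<close>

lemma sum_L_coeff_orthogonal:
  assumes "m < n"
  shows "(\<Sum>l=0..n. L_coeff k l n / real (l + m + k + 1)) = 0"
proof -
  have "(\<Prod>j<n. real (j + k + 1) - real (m + k + 1)) = 0"
    using assms by (intro prod_zero bexI[of _ m]) auto
  then show ?thesis
    using sum_L_coeff_divide[of "real (m + k + 1)" k n] by (simp add: add_ac)
qed

text \<open>The first moment that does not vanish, times the leading coefficient. Here the
  interpolated polynomial has the value n! up to sign, and its quotient with the leading coefficient
  cancels everything except the last factor 2n+k+1 of the denominator.\<close>

lemma sum_L_coeff_norm:
  "L_coeff k n n * (\<Sum>l=0..n. L_coeff k l n / real (l + n + k + 1)) = 1 / real (2 * n + k + 1)"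
proof -
  let ?R = "\<Prod>j<n. real (1 + k + n + j)"
  have R: "?R \<noteq> 0" by (simp del: of_nat_add)
  have "(\<Prod>j<n. real (j + k + 1) - real (n + k + 1)) = (\<Prod>j<n. - 1 * (real n - real j))"
    by (intro prod.cong) auto
  also have "\<dots> = (- 1) ^ n * (\<Prod>j<n. real n - real j)"
    by (simp only: prod.distrib prod_constant) simp
  also have "(\<Prod>j<n. real n - real j) = fact n"
    using prod_nodes_except[of n n] by (simp add: atLeast0AtMost lessThan_Suc_atMost[symmetric] lessThan_Suc)
  finally have 1: "(- 1) ^ n * (\<Prod>j<n. real (j + k + 1) - real (n + k + 1)) = fact n"
    by (simp flip: power_mult_distrib mult.assoc)
  have "(\<Prod>j\<in>{0..n}. real (n + k + 1) + real j) = ?R * real (2 * n + k + 1)"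
    by (simp add: atLeast0AtMost lessThan_Suc_atMost[symmetric] add_ac)
  then have "(\<Sum>l=0..n. L_coeff k l n / real (l + n + k + 1)) = fact n / (?R * real (2 * n + k + 1))"
    using sum_L_coeff_divide[of "real (n + k + 1)" k n] 1 by (simp add: add_ac)
  moreover have "L_coeff k n n = ?R / fact n" by (simp add: L_coeff_eq)
  ultimately show ?thesis using R by simp
qed

section \<open>Zernike functions on the half disk and their coefficients\<close>

definition disk_monomial :: "nat \<Rightarrow> nat \<Rightarrow> real \<times> real \<Rightarrow> real" where
  "disk_monomial k l p = Re (zmono (l + k) l p)"

definition zernike :: "nat \<Rightarrow> nat \<Rightarrow> real \<times> real \<Rightarrow> real" where
  "zernike k n p = (\<Sum>l=0..n. L_coeff k l n * disk_monomial k l p)"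

lemma disk_monomial_polar: "disk_monomial k l p = norm p ^ (2 * l + k) * cos (real k * polar_angle p)"
proof -
  have z: "cpx p = rcis (norm p) (polar_angle p)"
    using rcis_cmod_Arg[of "cpx p"] by (simp add: polar_angle_def cpx_def[symmetric])
  have "zmono (l + k) l p = (cpx p * cnj (cpx p)) ^ l * cpx p ^ k"
    by (simp add: zmono_def power_add power_mult_distrib mult_ac)
  also have "cpx p * cnj (cpx p) = of_real ((norm p)\<^sup>2)"
    using complex_norm_square[of "cpx p"] by simp
  also have "cpx p ^ k = rcis (norm p ^ k) (real k * polar_angle p)"
    by (subst z) (rule DeMoivre2)
  also have "of_real ((norm p)\<^sup>2) ^ l * rcis (norm p ^ k) (real k * polar_angle p)
     = rcis (norm p ^ (2 * l + k)) (real k * polar_angle p)"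
    by (simp add: rcis_def power_add power_mult)
  finally show ?thesis by (simp add: disk_monomial_def)
qed

lemma zernike_polar: "zernike k n p = L_poly k n (norm p) * cos (real k * polar_angle p)"
  by (simp add: zernike_def L_poly_def disk_monomial_polar sum_distrib_right mult.assoc)

lemma continuous_on_disk_monomial [continuous_intros]: "continuous_on A (disk_monomial k l)"
  unfolding disk_monomial_def by (intro continuous_intros)

lemma continuous_on_zernike [continuous_intros]: "continuous_on A (zernike k n)"
  unfolding zernike_def by (intro continuous_intros)

lemma Re_zmono_commute: "Re (zmono a b p) = Re (zmono b a p)"
proof -
  have "zmono b a p = cnj (zmono a b p)" by (simp add: zmono_def mult.commute)
  then show ?thesis by simp
qed

text \<open>Serves twice: it reduces inner products to single moments, and it shows that the span of
  these functions is an algebra.\<close>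

lemma disk_monomial_times:
  "disk_monomial k l p * disk_monomial k' l' p =
    (Re (zmono (l + l' + k + k') (l + l') p) + Re (zmono (l + l' + k) (l + l' + k') p)) / 2"
proof -
  have *: "Re z * Re w = (Re (z * w) + Re (z * cnj w)) / 2" for z w by simp
  have "zmono (l + k) l p * zmono (l' + k') l' p = zmono (l + l' + k + k') (l + l') p"
    by (simp add: zmono_def power_add mult_ac)
  moreover have "zmono (l + k) l p * cnj (zmono (l' + k') l' p) = zmono (l + l' + k) (l + l' + k') p"
    by (simp add: zmono_def power_add mult_ac)
  ultimately show ?thesis by (simp only: disk_monomial_def *)
qed

lemma sets_half_disk [measurable, simp]: "half_disk \<in> sets lebesgue"
  using open_half_disk by (simp add: lebesgue_openin)

lemma finite_measure_half_disk: "finite_measure (lebesgue_on half_disk)"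
proof -
  have "bounded half_disk" by (auto simp: half_disk_eq)
  then have "half_disk \<in> lmeasurable"
    by (intro bounded_set_imp_lmeasurable) simp_all
  then show ?thesis by (rule finite_measure_lebesgue_on)
qed

lemma sq_integrable_half_disk_continuous:
  fixes f :: "real \<times> real \<Rightarrow> real"
  assumes "continuous_on UNIV f"
  shows "sq_integrable (lebesgue_on half_disk) f"
proof -
  have "compact (f ` closure half_disk)"
    by (intro compact_continuous_image continuous_on_subset[OF assms])
       (auto simp: compact_closure half_disk_eq)
  then have "bounded (f ` closure half_disk)" by (rule compact_imp_bounded)
  then obtain B where "\<forall>y\<in>f ` closure half_disk. norm y \<le> B" unfolding bounded_iff by blast
  then have B: "\<And>x. x \<in> closure half_disk \<Longrightarrow> \<bar>f x\<bar> \<le> B" by simp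
  have "f \<in> borel_measurable (lebesgue_on half_disk)"
    by (rule continuous_imp_measurable_on_sets_lebesgue) (auto intro: continuous_on_subset[OF assms])
  moreover have "\<bar>f x\<bar> \<le> B" if "x \<in> space (lebesgue_on half_disk)" for x
    using that closure_subset[of half_disk] by (intro B) auto
  ultimately show ?thesis
    by (intro sq_integrable_bounded finite_measure_half_disk) auto
qed

lemma integrable_half_disk_continuous:
  fixes f :: "real \<times> real \<Rightarrow> real"
  assumes "continuous_on UNIV f"
  shows "integrable (lebesgue_on half_disk) f"
  using sq_integrable_times[OF sq_integrable_half_disk_continuous[OF assms]
      sq_integrable_half_disk_continuous[of "\<lambda>_. 1"]] by simp

text \<open>Of the two terms in the product formula, the one with k + k' contributes only for k = k'
  = 0, where both terms coincide; this doubles the value at k = 0.\<close>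

lemma integral_disk_monomial_times:
  "(\<integral>p. disk_monomial k l p * disk_monomial k' l' p \<partial>lebesgue_on half_disk) =
    (if k = k' then (if k = 0 then 2 else 1) * pi / (4 * real (l + l' + k + 1)) else 0)"
proof -
  have "integrable (lebesgue_on half_disk) (\<lambda>p. Re (zmono a b p))" for a b
    by (intro integrable_half_disk_continuous continuous_intros)
  then have "(\<integral>p. disk_monomial k l p * disk_monomial k' l' p \<partial>lebesgue_on half_disk) =
    ((\<integral>p. Re (zmono (l + l' + k + k') (l + l') p) \<partial>lebesgue_on half_disk)
     + (\<integral>p. Re (zmono (l + l' + k) (l + l' + k') p) \<partial>lebesgue_on half_disk)) / 2"
    by (simp add: disk_monomial_times)
  also have "\<dots> = (if k = k' then (if k = 0 then 2 else 1) * pi / (4 * real (l + l' + k + 1)) else 0)"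
  proof -
    have "(\<integral>p. Re (zmono (l + l' + k + k') (l + l') p) \<partial>lebesgue_on half_disk)
        = (if k = 0 \<and> k' = 0 then pi / (2 * real (l + l' + k + 1)) else 0)"
      by (auto simp: integral_half_disk_zmono add_ac)
    moreover have "(\<integral>p. Re (zmono (l + l' + k) (l + l' + k') p) \<partial>lebesgue_on half_disk)
        = (if k = k' then pi / (2 * real (l + l' + k + 1)) else 0)"
      by (auto simp: integral_half_disk_zmono add_ac)
    moreover have "(a / (2 * t) + a / (2 * t)) / 2 = 2 * a / (4 * t)" "(0 + a / (2 * t)) / 2 = 1 * a / (4 * t)" for a t :: real
      by simp_all
    ultimately show ?thesis by (cases "k = k'"; cases "k = 0") (simp_all del: of_nat_add)
  qed
  finally show ?thesis .
qed

lemma integral_zernike_disk_monomial: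
  "(\<integral>p. zernike k n p * disk_monomial k' m p \<partial>lebesgue_on half_disk) =
    (if k = k' then (if k = 0 then 2 else 1) * pi / 4 * (\<Sum>l=0..n. L_coeff k l n / real (l + m + k + 1)) else 0)"
proof -
  have "integrable (lebesgue_on half_disk) (\<lambda>p. disk_monomial k l p * disk_monomial k' m p)" for l
    by (intro integrable_half_disk_continuous continuous_intros)
  then have "(\<integral>p. zernike k n p * disk_monomial k' m p \<partial>lebesgue_on half_disk) =
     (\<Sum>l=0..n. L_coeff k l n * (\<integral>p. disk_monomial k l p * disk_monomial k' m p \<partial>lebesgue_on half_disk))"
    by (simp add: zernike_def sum_distrib_right mult.assoc)
  then show ?thesis
    by (simp add: integral_disk_monomial_times sum_distrib_left mult_ac)
qed

lemma integral_zernike_times: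
  "(\<integral>p. zernike k n p * zernike k' n' p \<partial>lebesgue_on half_disk) =
     (\<Sum>m=0..n'. L_coeff k' m n' * (\<integral>p. zernike k n p * disk_monomial k' m p \<partial>lebesgue_on half_disk))"
proof -
  have "integrable (lebesgue_on half_disk) (\<lambda>p. zernike k n p * disk_monomial k' m p)" for m
    by (intro integrable_half_disk_continuous continuous_intros)
  then show ?thesis
    by (simp add: zernike_def[of k' n'] sum_distrib_left mult.left_commute)
qed

lemma zernike_orthogonal:
  assumes "(k, n) \<noteq> (k', n')"
  shows "(\<integral>p. zernike k n p * zernike k' n' p \<partial>lebesgue_on half_disk) = 0"
proof -
  \<comment> \<open>For equal k it suffices to test the function with the larger index against
    monomials of lower degree. Different k are already separated by the angular integral.\<close>
  have less: "(\<integral>p. zernike k n p * zernike k n' p \<partial>lebesgue_on half_disk) = 0" if "n' < n" for n n'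
    unfolding integral_zernike_times integral_zernike_disk_monomial
  proof (intro sum.neutral ballI)
    fix m assume "m \<in> {0..n'}"
    then have "(\<Sum>l=0..n. L_coeff k l n / real (l + m + k + 1)) = 0"
      using that by (intro sum_L_coeff_orthogonal) simp
    then show "L_coeff k m n' * (if k = k then (if k = 0 then 2 else 1) * pi / 4 * (\<Sum>l=0..n. L_coeff k l n / real (l + m + k + 1)) else 0) = 0"
      by (simp only: mult_zero_right if_cancel)
  qed
  show ?thesis
  proof (cases "k = k'")
    case True
    then have "n \<noteq> n'" using assms by simp
    then consider "n' < n" | "n < n'" by linarith
    then show ?thesis
    proof cases
      case 2
      then show ?thesis using less[OF 2] True by (simp add: mult.commute)
    qed (use less True in simp)
  qed (simp add: integral_zernike_times integral_zernike_disk_monomial)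
qed

lemma zernike_norm:
  "(\<integral>p. (zernike k n p)\<^sup>2 \<partial>lebesgue_on half_disk) = (if k = 0 then 2 else 1) * pi / (4 * real (2 * n + k + 1))"
proof -
  let ?c = "(if k = 0 then 2 else 1) * pi / 4"
  have "(\<integral>p. (zernike k n p)\<^sup>2 \<partial>lebesgue_on half_disk) =
     (\<Sum>m=0..n. L_coeff k m n * (?c * (\<Sum>l=0..n. L_coeff k l n / real (l + m + k + 1))))"
    by (simp only: power2_eq_square integral_zernike_times integral_zernike_disk_monomial if_True refl)
  \<comment> \<open>By orthogonality to all lower monomials only the leading term of the second
    factor survives.\<close>
  also have "\<dots> = (\<Sum>m\<in>{n}. L_coeff k m n * (?c * (\<Sum>l=0..n. L_coeff k l n / real (l + m + k + 1))))"
    by (rule sum.mono_neutral_right) (use sum_L_coeff_orthogonal[of _ n k] in \<open>auto simp del: of_nat_add of_nat_Suc\<close>)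
  also have "\<dots> = ?c * (L_coeff k n n * (\<Sum>l=0..n. L_coeff k l n / real (l + n + k + 1)))"
    by (simp only: sum.insert[OF finite.emptyI empty_iff[THEN iffD1, THEN notI]] sum.empty) (simp add: mult_ac)
  also have "\<dots> = ?c * (1 / real (2 * n + k + 1))" by (simp only: sum_L_coeff_norm)
  finally show ?thesis by simp
qed

text \<open>The prefactor is the reciprocal of the squared norm for k >= 1 but twice the reciprocal
  for k = 0.\<close>

lemma p_coeff_eq:
  assumes "sq_integrable (lebesgue_on half_disk) \<gamma>"
  shows "p_coeff \<gamma> n k = 4 * real (2 * n + k + 1) / pi * (\<integral>p. \<gamma> p * zernike k n p \<partial>lebesgue_on half_disk)"
proof -
  define J where "J l = (\<integral>p. \<gamma> p * disk_monomial k l p \<partial>lebesgue_on half_disk)" for l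
  have i: "integrable (lebesgue_on half_disk) (\<lambda>p. \<gamma> p * disk_monomial k l p)" for l
    by (intro sq_integrable_times[OF assms] sq_integrable_half_disk_continuous continuous_intros)
  have "(\<integral>p. \<gamma> p * zernike k n p \<partial>lebesgue_on half_disk)
      = (\<integral>p. (\<Sum>l=0..n. L_coeff k l n * (\<gamma> p * disk_monomial k l p)) \<partial>lebesgue_on half_disk)"
    by (simp only: zernike_def sum_distrib_left mult.left_commute)
  also have "\<dots> = (\<Sum>l=0..n. L_coeff k l n * J l)"
    unfolding J_def using i by simp
  finally have "(\<integral>p. \<gamma> p * zernike k n p \<partial>lebesgue_on half_disk) = (\<Sum>l=0..n. L_coeff k l n * J l)" .
  moreover have "p_coeff \<gamma> n k = (\<Sum>l=0..n. 4 * real (2 * n + k + 1) / pi * (L_coeff k l n * J l))"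
    unfolding p_coeff_def
  proof (rule sum.cong[OF refl])
    fix l assume "l \<in> {0..n}"
    then have L: "L_coeff k l n = (- 1) ^ (n - l) * ((\<Prod>j<n. real (1 + k + l + j)) / (fact l * fact (n - l)))"
      by (simp add: L_coeff_eq)
    have D: "lin_DN_inc \<gamma> (sin_data (l + 1)) (sin_data (l + k + 1)) = real (l + 1) * real (l + 1 + k) * J l"
      using lin_DN_inc_sin_data[of \<gamma> l "l + k"] by (simp add: J_def disk_monomial_def add_ac)
    have "real (l + 1) * real (l + 1 + k) \<noteq> 0" by (simp del: of_nat_add)
    then have E: "2 * lin_DN_inc \<gamma> (sin_data (l + 1)) (sin_data (l + k + 1)) / (real (l + 1) * real (l + 1 + k) * pi) = 2 / pi * J l"
      unfolding D by (simp del: of_nat_add)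
    have *: "2 * s * N * X * (2 / pi * j) = 4 * N / pi * (s * X * j)" for s N X j :: real
      by simp
    show "2 * (- 1) ^ (n - l) * real (2 * n + k + 1) * ((\<Prod>j<n. real (1 + k + l + j)) / (fact l * fact (n - l)))
        * (2 * lin_DN_inc \<gamma> (sin_data (l + 1)) (sin_data (l + k + 1)) / (real (l + 1) * real (l + 1 + k) * pi))
      = 4 * real (2 * n + k + 1) / pi * (L_coeff k l n * J l)"
      unfolding L E by (rule *)
  qed
  ultimately show ?thesis by (simp add: sum_distrib_left)
qed

section \<open>Completeness\<close>

definition spanned_by :: "('i \<Rightarrow> 'a \<Rightarrow> real) \<Rightarrow> ('a \<Rightarrow> real) \<Rightarrow> bool" where
  "spanned_by E f \<longleftrightarrow> (\<exists>I b. finite I \<and> f = (\<lambda>x. \<Sum>i\<in>I. b i * E i x))"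

lemma spanned_by_base: "spanned_by E (E i)"
  unfolding spanned_by_def by (intro exI[of _ "{i}"] exI[of _ "\<lambda>_. 1"]) simp

lemma spanned_by_add:
  assumes "spanned_by E f" "spanned_by E g"
  shows "spanned_by E (\<lambda>x. f x + g x)"
proof -
  obtain I b J c where I: "finite I" "f = (\<lambda>x. \<Sum>i\<in>I. b i * E i x)"
    and J: "finite J" "g = (\<lambda>x. \<Sum>i\<in>J. c i * E i x)"
    using assms by (auto simp: spanned_by_def)
  define b' where "b' i = (if i \<in> I then b i else 0)" for i
  define c' where "c' i = (if i \<in> J then c i else 0)" for i
  have "f x = (\<Sum>i\<in>I \<union> J. b' i * E i x)" for x
    unfolding I(2) using I(1) J(1) by (intro sum.mono_neutral_cong_left) (auto simp: b'_def)
  moreover have "g x = (\<Sum>i\<in>I \<union> J. c' i * E i x)" for x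
    unfolding J(2) using I(1) J(1) by (intro sum.mono_neutral_cong_left) (auto simp: c'_def)
  ultimately have "(\<lambda>x. f x + g x) = (\<lambda>x. \<Sum>i\<in>I \<union> J. (b' i + c' i) * E i x)"
    by (simp add: fun_eq_iff sum.distrib distrib_right)
  then show ?thesis
    unfolding spanned_by_def using I(1) J(1)
    by (intro exI[of _ "I \<union> J"] exI[of _ "\<lambda>i. b' i + c' i"]) simp
qed

lemma spanned_by_cmult:
  assumes "spanned_by E f"
  shows "spanned_by E (\<lambda>x. c * f x)"
proof -
  obtain I b where I: "finite I" "f = (\<lambda>x. \<Sum>i\<in>I. b i * E i x)"
    using assms by (auto simp: spanned_by_def)
  then have "(\<lambda>x. c * f x) = (\<lambda>x. \<Sum>i\<in>I. (c * b i) * E i x)"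
    by (simp add: fun_eq_iff sum_distrib_left mult.assoc)
  then show ?thesis
    unfolding spanned_by_def using I(1) by (intro exI[of _ I] exI[of _ "\<lambda>i. c * b i"]) simp
qed

lemma spanned_by_sum:
  assumes "\<And>i. i \<in> I \<Longrightarrow> spanned_by E (f i)"
  shows "spanned_by E (\<lambda>x. \<Sum>i\<in>I. f i x)"
proof -
  have 0: "spanned_by E (\<lambda>x. 0)"
    unfolding spanned_by_def by (intro exI[of _ "{}"]) simp
  show ?thesis
  proof (cases "finite I")
    case True
    then show ?thesis using assms
      by (induction I) (simp_all add: 0 spanned_by_add)
  qed (simp add: 0)
qed

lemma spanned_by_trans:
  assumes "spanned_by E f" "\<And>i. spanned_by F (E i)"
  shows "spanned_by F f"
proof -
  obtain I b where f: "f = (\<lambda>x. \<Sum>i\<in>I. b i * E i x)"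
    using assms by (auto simp: spanned_by_def)
  show ?thesis unfolding f by (intro spanned_by_sum spanned_by_cmult assms)
qed

abbreviation disk_monomials :: "nat \<times> nat \<Rightarrow> real \<times> real \<Rightarrow> real" where
  "disk_monomials i \<equiv> disk_monomial (fst i) (snd i)"

abbreviation zernikes :: "nat \<times> nat \<Rightarrow> real \<times> real \<Rightarrow> real" where
  "zernikes i \<equiv> zernike (fst i) (snd i)"

lemma spanned_by_disk_monomial: "spanned_by disk_monomials (disk_monomial k l)"
  using spanned_by_base[of disk_monomials "(k, l)"] by simp

lemma spanned_by_zernike: "spanned_by zernikes (zernike k l)"
  using spanned_by_base[of zernikes "(k, l)"] by simp

text \<open>For fixed k the passage between the two families is triangular with nonzero diagonal
  entries \<open>L_coeff k l l\<close>.\<close>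

lemma disk_monomial_spanned_by_zernikes: "spanned_by zernikes (disk_monomial k l)"
proof (induction l rule: less_induct)
  case (less l)
  have "L_coeff k l l \<noteq> 0"
    by (simp add: L_coeff_eq prod_zero_iff del: of_nat_add)
  moreover have "zernike k l x = (\<Sum>i<l. L_coeff k i l * disk_monomial k i x) + L_coeff k l l * disk_monomial k l x" for x
    by (simp add: zernike_def atLeast0AtMost lessThan_Suc_atMost[symmetric])
  ultimately have "disk_monomial k l = (\<lambda>x. (1 / L_coeff k l l) * (zernike k l x + (\<Sum>i<l. - L_coeff k i l * disk_monomial k i x)))"
    by (simp add: fun_eq_iff sum_negf)
  moreover have "spanned_by zernikes (\<lambda>x. (1 / L_coeff k l l) * (zernike k l x + (\<Sum>i<l. - L_coeff k i l * disk_monomial k i x)))"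
    by (intro spanned_by_cmult spanned_by_add spanned_by_sum spanned_by_zernike less) auto
  ultimately show ?case by simp
qed

text \<open>In the product formula the second exponent may exceed the first; taking real parts
  allows the two to be exchanged.\<close>

lemma Re_zmono_spanned: "spanned_by disk_monomials (\<lambda>p. Re (zmono a b p))"
proof (cases "b \<le> a")
  case True
  then have "(\<lambda>p. Re (zmono a b p)) = disk_monomial (a - b) b"
    by (simp add: fun_eq_iff disk_monomial_def)
  then show ?thesis by (simp add: spanned_by_disk_monomial)
next
  case False
  then have "(\<lambda>p. Re (zmono a b p)) = disk_monomial (b - a) a"
    by (simp add: fun_eq_iff disk_monomial_def Re_zmono_commute[of a b])
  then show ?thesis by (simp add: spanned_by_disk_monomial)
qed

lemma spanned_by_disk_monomials_times:
  assumes "spanned_by disk_monomials f" "spanned_by disk_monomials g"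
  shows "spanned_by disk_monomials (\<lambda>x. f x * g x)"
proof -
  obtain I b J c where f: "f = (\<lambda>x. \<Sum>i\<in>I. b i * disk_monomials i x)"
    and g: "g = (\<lambda>x. \<Sum>j\<in>J. c j * disk_monomials j x)"
    using assms by (auto simp: spanned_by_def)
  have "spanned_by disk_monomials (\<lambda>x. disk_monomials i x * disk_monomials j x)" for i j
  proof -
    have "spanned_by disk_monomials (\<lambda>p. (1/2) * (Re (zmono a b p) + Re (zmono c d p)))" for a b c d
      by (intro spanned_by_cmult spanned_by_add Re_zmono_spanned)
    then show ?thesis by (simp add: disk_monomial_times)
  qed
  then have "spanned_by disk_monomials (\<lambda>x. \<Sum>i\<in>I. \<Sum>j\<in>J. (b i * c j) * (disk_monomials i x * disk_monomials j x))"
    by (intro spanned_by_sum spanned_by_cmult)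
  moreover have "(\<lambda>x. f x * g x) = (\<lambda>x. \<Sum>i\<in>I. \<Sum>j\<in>J. (b i * c j) * (disk_monomials i x * disk_monomials j x))"
    unfolding f g sum_product by (simp add: mult_ac)
  ultimately show ?thesis by simp
qed

lemma spanned_by_continuous:
  assumes "spanned_by E f" "\<And>i. continuous_on A (E i)"
  shows "continuous_on A f"
  using assms by (auto simp: spanned_by_def intro!: continuous_intros)

lemma zernike_uniform_approximation:
  fixes f :: "real \<times> real \<Rightarrow> real"
  assumes "continuous_on (closure half_disk) f" "0 < e"
  shows "\<exists>g. spanned_by zernikes g \<and> (\<forall>x\<in>closure half_disk. \<bar>f x - g x\<bar> < e)"
proof -
  have "\<exists>g. spanned_by disk_monomials g \<and> (\<forall>x\<in>closure half_disk. \<bar>f x - g x\<bar> < e)"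
  proof (rule Stone_Weierstrass_HOL[OF _ _ _ _ _ _ assms])
    show "compact (closure half_disk)" by (auto simp: compact_closure half_disk_eq)
    show "spanned_by disk_monomials (\<lambda>x. c)" for c
    proof -
      have "spanned_by disk_monomials (\<lambda>x. c * disk_monomial 0 0 x)"
        by (intro spanned_by_cmult spanned_by_disk_monomial)
      then show ?thesis by (simp add: disk_monomial_def zmono_def)
    qed
    show "continuous_on (closure half_disk) g" if "spanned_by disk_monomials g" for g
      using that by (rule spanned_by_continuous) (rule continuous_on_disk_monomial)
    show "spanned_by disk_monomials (\<lambda>x. g x + h x)" if "spanned_by disk_monomials g \<and> spanned_by disk_monomials h" for g h
      using that by (intro spanned_by_add) auto
    show "spanned_by disk_monomials (\<lambda>x. g x * h x)" if "spanned_by disk_monomials g \<and> spanned_by disk_monomials h" for g h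
      using that by (intro spanned_by_disk_monomials_times) auto
    fix p q assume pq: "p \<in> closure half_disk \<and> q \<in> closure half_disk \<and> p \<noteq> q"
    then have pos: "0 \<le> snd p" "0 \<le> snd q" using closure_half_disk by auto
    have fst: "disk_monomial 1 0 r = fst r" for r
      by (simp add: disk_monomial_def zmono_def cpx_def)
    have norm: "disk_monomial 0 1 r = (fst r)\<^sup>2 + (snd r)\<^sup>2" for r
      by (simp add: disk_monomial_def zmono_def cpx_def power2_eq_square)
    \<comment> \<open>Since y >= 0, the abscissa and the norm determine the point. On the full disk
      every function in the span is even in y and mirror images could not be separated.\<close>
    have "disk_monomial 1 0 p \<noteq> disk_monomial 1 0 q \<or> disk_monomial 0 1 p \<noteq> disk_monomial 0 1 q"
      unfolding fst norm using pq pos by (auto simp: prod_eq_iff)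
    then show "\<exists>g. spanned_by disk_monomials g \<and> g p \<noteq> g q"
      using spanned_by_disk_monomial by blast
  qed
  then show ?thesis
    using spanned_by_trans[OF _ disk_monomial_spanned_by_zernikes] by blast
qed

section \<open>Density in L^2\<close>

lemma integral_square_tendsto_0:
  fixes s :: "nat \<Rightarrow> 'a \<Rightarrow> real"
  assumes [measurable]: "f \<in> borel_measurable M" "\<And>n. s n \<in> borel_measurable M"
    and w: "integrable M w" and lim: "AE x in M. (\<lambda>n. s n x) \<longlonglongrightarrow> f x"
    and bound: "\<And>n. AE x in M. (f x - s n x)\<^sup>2 \<le> w x"
  shows "(\<lambda>n. \<integral>x. (f x - s n x)\<^sup>2 \<partial>M) \<longlonglongrightarrow> 0"
proof -
  have "(\<lambda>n. \<integral>x. (f x - s n x)\<^sup>2 \<partial>M) \<longlonglongrightarrow> (\<integral>x. 0 \<partial>M)"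
  proof (rule integral_dominated_convergence[OF _ _ w])
    show "AE x in M. (\<lambda>n. (f x - s n x)\<^sup>2) \<longlonglongrightarrow> 0"
      using lim
    proof eventually_elim
      case (elim x)
      then have "(\<lambda>n. (f x - s n x)\<^sup>2) \<longlonglongrightarrow> (f x - f x)\<^sup>2" by (intro tendsto_intros)
      then show ?case by simp
    qed
    show "AE x in M. norm ((f x - s n x)\<^sup>2) \<le> w x" for n
      using bound[of n] by eventually_elim simp
  qed auto
  then show ?thesis by simp
qed

definition clamp_real :: "real \<Rightarrow> real \<Rightarrow> real" where
  "clamp_real m y = max (- m) (min m y)"

text \<open>Measurability supplies continuous functions converging almost everywhere, but without
  any bound. Clamping first \<gamma> and then the approximants at the same level \<open>m\<close>
  provides dominating functions: the square of \<gamma> in the first step, a constant over a finite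
  measure in the second.\<close>

lemma continuous_approximation:
  fixes \<gamma> :: "'a::euclidean_space \<Rightarrow> real"
  assumes A: "A \<in> sets lebesgue" and fin: "finite_measure (lebesgue_on A)"
    and \<gamma>: "sq_integrable (lebesgue_on A) \<gamma>" and "0 < \<epsilon>"
  shows "\<exists>g. continuous_on UNIV g \<and> (\<integral>x. (\<gamma> x - g x)\<^sup>2 \<partial>lebesgue_on A) < \<epsilon>"
proof -
  let ?M = "lebesgue_on A"
  interpret finite_measure ?M by fact
  have [measurable]: "\<gamma> \<in> borel_measurable ?M" using \<gamma> by (simp add: sq_integrable_def)
  have [measurable]: "clamp_real m \<in> borel_measurable borel" for m
    unfolding clamp_real_def by measurable
  have lim1: "(\<lambda>m. \<integral>x. (\<gamma> x - clamp_real (real m) (\<gamma> x))\<^sup>2 \<partial>?M) \<longlonglongrightarrow> 0"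
  proof (rule integral_square_tendsto_0[OF _ _ sq_integrable_square[OF \<gamma>]])
    have "(\<lambda>m. clamp_real (real m) y) \<longlonglongrightarrow> y" for y
    proof (rule tendsto_eventually, rule eventually_sequentiallyI)
      fix m assume "nat \<lceil>\<bar>y\<bar>\<rceil> \<le> m"
      then have "\<bar>y\<bar> \<le> real m" by linarith
      then show "clamp_real (real m) y = y" by (auto simp: clamp_real_def)
    qed
    then show "AE x in ?M. (\<lambda>m. clamp_real (real m) (\<gamma> x)) \<longlonglongrightarrow> \<gamma> x" by simp
    have "\<bar>y - clamp_real (real m) y\<bar> \<le> \<bar>y\<bar>" for y m
      by (auto simp: clamp_real_def max_def min_def)
    then have "(y - clamp_real (real m) y)\<^sup>2 \<le> y\<^sup>2" for y m
      by (simp add: abs_le_square_iff)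
    then show "AE x in ?M. (\<gamma> x - clamp_real (real m) (\<gamma> x))\<^sup>2 \<le> (\<gamma> x)\<^sup>2" for m by simp
  qed measurable
  then obtain m where m: "(\<integral>x. (\<gamma> x - clamp_real (real m) (\<gamma> x))\<^sup>2 \<partial>?M) < \<epsilon> / 4"
    using order_tendstoD(2)[OF lim1, of "\<epsilon> / 4"] \<open>0 < \<epsilon>\<close> by (auto simp: eventually_sequentially)
  have bnd: "\<bar>clamp_real (real m) y\<bar> \<le> real m" for y
    by (auto simp: clamp_real_def)
  \<comment> \<open>By definition \<open>measurable_on\<close> means being a limit of continuous
    functions off a negligible set.\<close>
  have "\<gamma> measurable_on A"
    by (simp add: measurable_on_iff_borel_measurable[OF A])
  then obtain N g where N: "negligible N" and g: "\<And>n. continuous_on UNIV (g n)"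
    and lim: "\<And>x. x \<notin> N \<Longrightarrow> (\<lambda>n. g n x) \<longlonglongrightarrow> (if x \<in> A then \<gamma> x else 0)"
    unfolding measurable_on_def by blast
  have gm: "g n \<in> borel_measurable ?M" for n
    using continuous_imp_measurable_on_sets_lebesgue[OF continuous_on_subset[OF g subset_UNIV] A] .
  note [measurable] = gm
  have N': "AE x in ?M. x \<notin> N"
  proof -
    have "N \<in> null_sets lebesgue" using N by (simp add: negligible_iff_null_sets)
    then have "AE x in lebesgue. x \<notin> N" by (rule AE_not_in)
    then show ?thesis using A by (auto simp: AE_restrict_space_iff elim: eventually_mono)
  qed
  have cc: "continuous_on UNIV (\<lambda>x. clamp_real (real m) (g n x))" for n
    unfolding clamp_real_def by (intro continuous_intros g)
  have lim2: "(\<lambda>n. \<integral>x. (clamp_real (real m) (\<gamma> x) - clamp_real (real m) (g n x))\<^sup>2 \<partial>?M) \<longlonglongrightarrow> 0"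
  proof (rule integral_square_tendsto_0)
    show "integrable ?M (\<lambda>x. (2 * real m)\<^sup>2)" by simp
    have "AE x in ?M. x \<in> A" using A by (simp add: AE_restrict_space_iff)
    with N' show "AE x in ?M. (\<lambda>n. clamp_real (real m) (g n x)) \<longlonglongrightarrow> clamp_real (real m) (\<gamma> x)"
    proof eventually_elim
      case (elim x)
      then have "(\<lambda>n. g n x) \<longlonglongrightarrow> \<gamma> x" using lim[of x] by simp
      then show ?case unfolding clamp_real_def by (intro tendsto_intros)
    qed
    have "(clamp_real (real m) y - clamp_real (real m) z)\<^sup>2 \<le> (2 * real m)\<^sup>2" for y z
    proof -
      have "\<bar>clamp_real (real m) y - clamp_real (real m) z\<bar> \<le> 2 * real m"
        using bnd[of y] bnd[of z] by linarith
      then show ?thesis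
        using abs_le_square_iff[of "clamp_real (real m) y - clamp_real (real m) z" "2 * real m"] by simp
    qed
    then show "AE x in ?M. (clamp_real (real m) (\<gamma> x) - clamp_real (real m) (g n x))\<^sup>2 \<le> (2 * real m)\<^sup>2" for n
      by (intro AE_I2)
    show "(\<lambda>x. clamp_real (real m) (\<gamma> x)) \<in> borel_measurable ?M" by measurable
    show "(\<lambda>x. clamp_real (real m) (g n x)) \<in> borel_measurable ?M" for n by measurable
  qed
  then obtain n where n: "(\<integral>x. (clamp_real (real m) (\<gamma> x) - clamp_real (real m) (g n x))\<^sup>2 \<partial>?M) < \<epsilon> / 4"
    using order_tendstoD(2)[OF lim2, of "\<epsilon> / 4"] \<open>0 < \<epsilon>\<close> by (auto simp: eventually_sequentially)
  have c1: "sq_integrable ?M (\<lambda>x. clamp_real (real m) (\<gamma> x))"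
    using bnd by (intro sq_integrable_bounded fin) auto
  have c2: "sq_integrable ?M (\<lambda>x. clamp_real (real m) (g n x))"
    using bnd by (intro sq_integrable_bounded fin) auto
  have "(\<integral>x. (\<gamma> x - clamp_real (real m) (g n x))\<^sup>2 \<partial>?M)
    = (\<integral>x. ((\<gamma> x - clamp_real (real m) (\<gamma> x)) + (clamp_real (real m) (\<gamma> x) - clamp_real (real m) (g n x)))\<^sup>2 \<partial>?M)"
    by simp
  also have "\<dots> \<le> 2 * (\<integral>x. (\<gamma> x - clamp_real (real m) (\<gamma> x))\<^sup>2 \<partial>?M)
      + 2 * (\<integral>x. (clamp_real (real m) (\<gamma> x) - clamp_real (real m) (g n x))\<^sup>2 \<partial>?M)"
    by (intro integral_square_add_le sq_integrable_diff \<gamma> c1 c2)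
  also have "\<dots> < \<epsilon>" using m n by simp
  finally show ?thesis using cc by blast
qed

lemma zernike_dense:
  assumes \<gamma>: "sq_integrable (lebesgue_on half_disk) \<gamma>" and "0 < \<epsilon>"
  shows "\<exists>f. spanned_by zernikes f \<and> (\<integral>x. (\<gamma> x - f x)\<^sup>2 \<partial>lebesgue_on half_disk) < \<epsilon>"
proof -
  let ?M = "lebesgue_on half_disk"
  interpret finite_measure ?M by (rule finite_measure_half_disk)
  obtain g where g: "continuous_on UNIV g" "(\<integral>x. (\<gamma> x - g x)\<^sup>2 \<partial>?M) < \<epsilon> / 4"
    using continuous_approximation[OF sets_half_disk finite_measure_half_disk \<gamma>, of "\<epsilon> / 4"] \<open>0 < \<epsilon>\<close> by auto
  define \<mu> where "\<mu> = measure ?M half_disk"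
  have \<mu>: "0 \<le> \<mu>" by (simp add: \<mu>_def)
  \<comment> \<open>Chosen such that \<delta>^2 times the measure is at most \<epsilon>/4; the added
    1 avoids a separate case of measure zero.\<close>
  define \<delta> where "\<delta> = sqrt (\<epsilon> / (4 * (\<mu> + 1)))"
  have \<delta>: "0 < \<delta>" using \<mu> \<open>0 < \<epsilon>\<close> by (simp add: \<delta>_def)
  obtain f where f: "spanned_by zernikes f" "\<And>x. x \<in> closure half_disk \<Longrightarrow> \<bar>g x - f x\<bar> < \<delta>"
    using zernike_uniform_approximation[OF continuous_on_subset[OF g(1)] \<delta>] by blast
  have sg: "sq_integrable ?M g" and sf: "sq_integrable ?M f"
    using g(1) spanned_by_continuous[OF f(1) continuous_on_zernike]
    by (auto intro: sq_integrable_half_disk_continuous)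
  have "(\<integral>x. (g x - f x)\<^sup>2 \<partial>?M) \<le> (\<integral>x. \<delta>\<^sup>2 \<partial>?M)"
  proof (rule integral_mono)
    fix x assume "x \<in> space ?M"
    then have "\<bar>g x - f x\<bar> < \<delta>" using closure_subset[of half_disk] by (intro f) auto
    then show "(g x - f x)\<^sup>2 \<le> \<delta>\<^sup>2" using \<delta> by (simp add: abs_le_square_iff[symmetric])
  qed (use sq_integrable_square[OF sq_integrable_diff[OF sg sf]] in simp_all)
  also have "\<dots> = \<epsilon> / (4 * (\<mu> + 1)) * \<mu>"
    using \<mu> \<open>0 < \<epsilon>\<close> by (simp add: \<delta>_def \<mu>_def[symmetric])
  also have "\<dots> \<le> \<epsilon> / 4"
    using \<mu> \<open>0 < \<epsilon>\<close> by (simp add: field_simps)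
  finally have fg: "(\<integral>x. (g x - f x)\<^sup>2 \<partial>?M) \<le> \<epsilon> / 4" .
  have "(\<integral>x. (\<gamma> x - f x)\<^sup>2 \<partial>?M) = (\<integral>x. ((\<gamma> x - g x) + (g x - f x))\<^sup>2 \<partial>?M)" by simp
  also have "\<dots> \<le> 2 * (\<integral>x. (\<gamma> x - g x)\<^sup>2 \<partial>?M) + 2 * (\<integral>x. (g x - f x)\<^sup>2 \<partial>?M)"
    by (intro integral_square_add_le sq_integrable_diff \<gamma> sg sf)
  also have "\<dots> < \<epsilon>" using g(2) fg by simp
  finally show ?thesis using f(1) by blast
qed

section \<open>The reconstruction formula\<close>

lemma L2_on_iff_sq_integrable: "L2_on A f \<longleftrightarrow> sq_integrable (lebesgue_on A) f"
  by (simp add: L2_on_def sq_integrable_def)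

lemma L2_convergesI:
  assumes "\<And>N. sq_integrable (lebesgue_on A) (F N)" "sq_integrable (lebesgue_on A) f"
    and "(\<lambda>N. \<integral>x. (F N x - f x)\<^sup>2 \<partial>lebesgue_on A) \<longlonglongrightarrow> 0"
  shows "L2_converges A F f"
proof -
  have "(\<lambda>N. L2_dist A (F N) f) \<longlonglongrightarrow> sqrt 0"
    unfolding L2_dist_def by (intro tendsto_real_sqrt assms)
  then show ?thesis using assms by (simp add: L2_converges_def L2_on_iff_sq_integrable)
qed

theorem mainTheorem4:
  fixes \<gamma> :: "real \<times> real \<Rightarrow> real"
  assumes "L2_on half_disk \<gamma>"
  shows "\<exists>(S\<^sub>0 :: real \<times> real \<Rightarrow> real) (S :: nat \<Rightarrow> real \<times> real \<Rightarrow> real).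
    L2_sums half_disk (\<lambda>n x. L_poly 0 n (norm x) * p_coeff \<gamma> n 0) S\<^sub>0 \<and>
    (\<forall>k\<ge>1. L2_sums half_disk
       (\<lambda>n x. L_poly k n (norm x) * cos (real k * polar_angle x) * p_coeff \<gamma> n k) (S k)) \<and>
    L2_converges half_disk (\<lambda>K x. 1 / 2 * S\<^sub>0 x + (\<Sum>k=1..K. S k x)) \<gamma>"
proof -
  let ?M = "lebesgue_on half_disk"
  have \<gamma>: "sq_integrable ?M \<gamma>" using assms by (simp add: L2_on_iff_sq_integrable)
  have z: "sq_integrable ?M (zernike k n)" for k n
    by (intro sq_integrable_half_disk_continuous continuous_on_zernike)
  \<comment> \<open>The true Fourier coefficients; the halving at k = 0 corrects the factor 2 by
    which \<open>p_coeff\<close> exceeds them there.\<close>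
  define a where "a k n = (if k = 0 then 1 / 2 else 1) * p_coeff \<gamma> n k" for k n
  have a: "(\<integral>x. \<gamma> x * zernike k n x \<partial>?M) = a k n * (\<integral>x. (zernike k n x)\<^sup>2 \<partial>?M)" for k n
    by (simp add: a_def zernike_norm p_coeff_eq[OF \<gamma>] del: of_nat_add of_nat_Suc)
  have dense: "\<exists>I b. finite I \<and> (\<integral>x. (\<gamma> x - (\<Sum>(k, n)\<in>I. b (k, n) * zernike k n x))\<^sup>2 \<partial>?M) < \<epsilon>"
    if \<epsilon>: "0 < \<epsilon>" for \<epsilon>
  proof -
    obtain I b where "finite I" "(\<integral>x. (\<gamma> x - (\<Sum>i\<in>I. b i * zernikes i x))\<^sup>2 \<partial>?M) < \<epsilon>"
      using zernike_dense[OF \<gamma> \<epsilon>] by (auto simp: spanned_by_def)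
    then show ?thesis by (intro exI[of _ I] exI[of _ b]) (simp add: case_prod_unfold)
  qed
  obtain S where S: "\<And>k. sq_integrable ?M (S k)"
    "\<And>k. (\<lambda>N. \<integral>x. ((\<Sum>n<N. a k n * zernike k n x) - S k x)\<^sup>2 \<partial>?M) \<longlonglongrightarrow> 0"
    "(\<lambda>K. \<integral>x. ((\<Sum>k\<le>K. S k x) - \<gamma> x)\<^sup>2 \<partial>?M) \<longlonglongrightarrow> 0"
    by (rule orthogonal_double_series[OF finite_measure_half_disk \<gamma> z zernike_orthogonal a dense])
      (assumption | rule that)+
  show ?thesis
  \<comment> \<open>The formula keeps its factor 1/2 outside the first series, so the limit of that
    series is twice the Fourier row \<open>S 0\<close>.\<close>
  proof (intro exI[of _ "\<lambda>x. 2 * S 0 x"] exI[of _ S] conjI allI impI)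
    have eq: "(\<Sum>n<N. L_poly 0 n (norm x) * p_coeff \<gamma> n 0) = 2 * (\<Sum>n<N. a 0 n * zernike 0 n x)" for N x
      by (simp add: sum_distrib_left a_def zernike_polar mult_ac)
    have eq2: "(2 * u - 2 * v)\<^sup>2 = 4 * (u - v)\<^sup>2" for u v :: real
      by (simp add: power2_eq_square algebra_simps)
    show "L2_sums half_disk (\<lambda>n x. L_poly 0 n (norm x) * p_coeff \<gamma> n 0) (\<lambda>x. 2 * S 0 x)"
      unfolding L2_sums_def eq
    proof (rule L2_convergesI)
      show "(\<lambda>N. \<integral>x. (2 * (\<Sum>n<N. a 0 n * zernike 0 n x) - 2 * S 0 x)\<^sup>2 \<partial>?M) \<longlonglongrightarrow> 0"
        using tendsto_mult_left[OF S(2)[of 0], of 4] by (simp add: eq2)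
    qed (intro sq_integrable_cmult sq_integrable_sum z S)+
    fix k :: nat assume "1 \<le> k"
    then have eq: "(\<Sum>n<N. L_poly k n (norm x) * cos (real k * polar_angle x) * p_coeff \<gamma> n k) = (\<Sum>n<N. a k n * zernike k n x)" for N x
      by (simp add: a_def zernike_polar mult_ac)
    show "L2_sums half_disk (\<lambda>n x. L_poly k n (norm x) * cos (real k * polar_angle x) * p_coeff \<gamma> n k) (S k)"
      unfolding L2_sums_def eq
      by (rule L2_convergesI) (intro sq_integrable_cmult sq_integrable_sum z S)+
  next
    have eq: "1 / 2 * (2 * S 0 x) + (\<Sum>k=1..K. S k x) = (\<Sum>k\<le>K. S k x)" for K x
      by (simp add: sum.atMost_shift sum.atLeast1_atMost_eq lessThan_atLeast0)
    show "L2_converges half_disk (\<lambda>K x. 1 / 2 * (2 * S 0 x) + (\<Sum>k=1..K. S k x)) \<gamma>"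
      unfolding eq by (rule L2_convergesI) (intro sq_integrable_sum S \<gamma>)+
  qed
qed

end
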